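(* Let $(\Omega,\mu)$ be a measure space and let $X=L^p(\Omega,\mu)$ (complex-valued functions) with $1\le p\le+\infty$. Let $h\in L^p(\Omega,\mu)$ with $h>0$ a.e. and $m\in L^q(\Omega,\mu)$ with $m>0$ a.e., where $\frac1p+\frac1q=1$, be such that $0<\int_\Omega h\,m\,d\mu<+\infty$. Given a complex-valued $g\in L^\infty(\Omega\times\Omega)$ define the integral operator $M_g\in L(X)$ by $$M_g\phi(x)=h(x)\int_\Omega e^{g(x,y)}\phi(y)\,m(y)\,\mu(dy).$$ Set $\theta=\operatorname{osc}(\operatorname{Im}g)$ and $\Lambda=\operatorname{osc}(\operatorname{Re}g)$. Suppose that $\theta<\pi/4$ and that $\tan\theta<\exp(-2\Lambda)$. Then $M_g$ has a spectral gap.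
   Context: For a real-valued measurable function $k$ on a measure space, $\operatorname{osc}(k)=\operatorname{ess\,sup}(k)-\operatorname{ess\,inf}(k)$ (here on $\Omega\times\Omega$ with $\mu\otimes\mu$). $L(X)$ denotes bounded linear operators on $X$. A bounded operator has a spectral gap if it has a simple isolated eigenvalue whose modulus equals the spectral radius $r_{\rm sp}$ and the remaining part of the spectrum is contained in a disk centered at $0$ of radius strictly smaller than $r_{\rm sp}$. *)

theory Defs
  imports "HOL-Probability.Probability"
begin

text \<open>
  The space \<open>L\<^sup>p\<close> is represented by functions rather than by classes modulo null sets, so
  every equation between its elements is stated almost everywhere and operators act on
  representatives. All exponents are of type \<^typ>\<open>ennreal\<close>, and are meant to be at least 1.
\<close>

definition Lp :: "ennreal \<Rightarrow> 'a measure \<Rightarrow> ('a \<Rightarrow> 'b::real_normed_vector) set" where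
  "Lp p M = {f \<in> borel_measurable M.
     if p = \<infinity> then esssup M (\<lambda>x. ennreal (norm (f x))) < \<infinity>
     else integrable M (\<lambda>x. norm (f x) powr enn2real p)}"

definition Lp_norm :: "ennreal \<Rightarrow> 'a measure \<Rightarrow> ('a \<Rightarrow> 'b::real_normed_vector) \<Rightarrow> real" where
  "Lp_norm p M f =
     (if p = \<infinity> then enn2real (esssup M (\<lambda>x. ennreal (norm (f x))))
      else (LINT x|M. norm (f x) powr enn2real p) powr (1 / enn2real p))"

text \<open>The essential infimum of \<open>k\<close> is \<open>- esssup M (- k)\<close>.\<close>

definition osc :: "'a measure \<Rightarrow> ('a \<Rightarrow> real) \<Rightarrow> ereal" where
  "osc M k = esssup M (\<lambda>x. ereal (k x)) - (- esssup M (\<lambda>x. ereal (- k x)))"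

text \<open>
  Linearity and boundedness imply that \<open>T\<close> maps functions which agree almost everywhere to
  functions which agree almost everywhere, so that it induces an operator on the quotient.
\<close>

definition Lp_bounded_op ::
    "ennreal \<Rightarrow> 'a measure \<Rightarrow> (('a \<Rightarrow> complex) \<Rightarrow> ('a \<Rightarrow> complex)) \<Rightarrow> bool" where
  "Lp_bounded_op p M T \<longleftrightarrow>
     (\<forall>\<phi>\<in>Lp p M. T \<phi> \<in> Lp p M) \<and>
     (\<forall>\<phi>\<in>Lp p M. \<forall>\<psi>\<in>Lp p M. \<forall>a b.
        AE x in M. T (\<lambda>y. a * \<phi> y + b * \<psi> y) x = a * T \<phi> x + b * T \<psi> x) \<and>
     (\<exists>C. \<forall>\<phi>\<in>Lp p M. Lp_norm p M (T \<phi>) \<le> C * Lp_norm p M \<phi>)"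

text \<open>The \<open>z\<close> for which \<open>zI - T\<close> has a bounded two-sided inverse.\<close>

definition Lp_resolvent_set ::
    "ennreal \<Rightarrow> 'a measure \<Rightarrow> (('a \<Rightarrow> complex) \<Rightarrow> ('a \<Rightarrow> complex)) \<Rightarrow> complex set" where
  "Lp_resolvent_set p M T = {z. \<exists>S. Lp_bounded_op p M S \<and>
     (\<forall>\<phi>\<in>Lp p M.
        (AE x in M. S (\<lambda>y. z * \<phi> y - T \<phi> y) x = \<phi> x) \<and>
        (AE x in M. z * S \<phi> x - T (S \<phi>) x = \<phi> x))}"

definition Lp_spectrum ::
    "ennreal \<Rightarrow> 'a measure \<Rightarrow> (('a \<Rightarrow> complex) \<Rightarrow> ('a \<Rightarrow> complex)) \<Rightarrow> complex set" where
  "Lp_spectrum p M T = - Lp_resolvent_set p M T"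

definition Lp_spectral_radius ::
    "ennreal \<Rightarrow> 'a measure \<Rightarrow> (('a \<Rightarrow> complex) \<Rightarrow> ('a \<Rightarrow> complex)) \<Rightarrow> real" where
  "Lp_spectral_radius p M T = Sup (cmod ` Lp_spectrum p M T)"

text \<open>
  Simple means algebraically simple: \<open>ker (zI - T)\<close> is spanned by one nonzero vector \<open>v\<close>, and the
  whole space is the direct sum of this kernel and the range of \<open>zI - T\<close>; the uniqueness of \<open>c\<close>
  says that the sum is direct. For an isolated point of the spectrum this holds iff the Riesz
  spectral projection has rank one; one-dimensionality of the generalized eigenspace
  \<open>\<Union>n. ker (zI - T)^n\<close> follows from it, but is weaker in infinite dimension.
\<close>

definition Lp_simple_eigenvalue ::
    "ennreal \<Rightarrow> 'a measure \<Rightarrow> (('a \<Rightarrow> complex) \<Rightarrow> ('a \<Rightarrow> complex)) \<Rightarrow> complex \<Rightarrow> bool" where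
  "Lp_simple_eigenvalue p M T z \<longleftrightarrow>
     (\<exists>v\<in>Lp p M. \<not> (AE x in M. v x = 0) \<and> (AE x in M. T v x = z * v x) \<and>
        (\<forall>\<phi>\<in>Lp p M. (AE x in M. T \<phi> x = z * \<phi> x) \<longrightarrow> (\<exists>c. AE x in M. \<phi> x = c * v x)) \<and>
        (\<forall>f\<in>Lp p M. \<exists>!c. \<exists>u\<in>Lp p M. AE x in M. f x = c * v x + (z * u x - T u x)))"

definition Lp_spectral_gap ::
    "ennreal \<Rightarrow> 'a measure \<Rightarrow> (('a \<Rightarrow> complex) \<Rightarrow> ('a \<Rightarrow> complex)) \<Rightarrow> bool" where
  "Lp_spectral_gap p M T \<longleftrightarrow> Lp_bounded_op p M T \<and>
     (\<exists>z. Lp_simple_eigenvalue p M T z \<and> z isolated_in Lp_spectrum p M T \<and>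
        cmod z = Lp_spectral_radius p M T \<and>
        (\<exists>\<rho>. 0 \<le> \<rho> \<and> \<rho> < Lp_spectral_radius p M T \<and>
             Lp_spectrum p M T - {z} \<subseteq> cball 0 \<rho>))"

text \<open>
  The theory of \<open>M \<Otimes>\<^sub>M M\<close> needs \<open>M\<close> to be sigma-finite. This holds as soon as some \<open>L\<^sup>p\<close>
  space with finite \<open>p\<close> contains an almost everywhere positive function, and so whenever
  \<open>h \<in> Lp p M\<close> and \<open>m \<in> Lp q M\<close> are such functions for conjugate exponents \<open>p\<close>, \<open>q\<close>.
\<close>

definition integral_op ::
    "'a measure \<Rightarrow> ('a \<Rightarrow> real) \<Rightarrow> ('a \<Rightarrow> real) \<Rightarrow> ('a \<times> 'a \<Rightarrow> complex) \<Rightarrow>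
       ('a \<Rightarrow> complex) \<Rightarrow> ('a \<Rightarrow> complex)" where
  "integral_op M h m g \<phi> =
     (\<lambda>x. of_real (h x) * (LINT y|M. exp (g (x, y)) * \<phi> y * of_real (m y)))"

end

theory Submission
  imports Defs
begin

text \<open>
  Dividing by \<open>h\<close> turns \<open>M\<^sub>g\<close> into an operator \<open>N\<close> on bounded functions, with kernel
  \<open>k = exp g\<close> with respect to the finite measure \<open>h m d\<mu>\<close>. Call a function acute if its values
  pairwise enclose an angle less than \<open>\<pi>/2\<close>. An acute function is \<open>u + \<i> v\<close> with \<open>u, v \<ge> 0\<close> up
  to a rotation, and \<open>tan \<theta> < exp (- 2 \<Lambda>)\<close> says exactly that the cross terms in
  \<open>Re (N f x * cnj (N f y))\<close> are dominated by the diagonal ones, so that \<open>N\<close> maps acute functions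
  to uniformly acute functions.

  Given \<open>f\<close> acute and \<open>g\<close> bounded, \<open>\<xi> f + g\<close> is acute for all \<open>\<xi>\<close> outside a disc, which then
  contains the values of \<open>- g / f\<close>. Replacing \<open>f, g\<close> by \<open>N f, N g\<close> lets the disc shrink by a
  fixed factor \<open>\<eta> < 1\<close>, because the new bad values of \<open>\<xi>\<close> have bounded hyperbolic diameter in the
  old disc. Hence \<open>N\<^sup>n g / N\<^sup>n 1\<close> converges uniformly to a constant \<open>\<ell> g\<close> at rate \<open>\<eta>\<^sup>n\<close>. The
  functional \<open>\<ell>\<close> satisfies \<open>\<ell> (N g) = \<lambda> \<ell> g\<close>, on its kernel the powers of \<open>N\<close> are
  \<open>O((\<eta> |\<lambda>|)\<^sup>n)\<close>, and Neumann series give the eigenfunction and the resolvent outside the disc of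
  radius \<open>\<eta> |\<lambda>|\<close>.
\<close>

section \<open>Pairwise acute complex numbers\<close>

text \<open>Acuteness compares pairs of values, so it ignores a common phase; it does the work of a
  positive cone. The exponent \<open>2 \<Lambda>\<close> arises because one kernel value is
  multiplied by the conjugate of another: the real part is at least
  \<open>A = exp (2 inf Re g) cos \<theta>\<close>, the imaginary part at most
  \<open>D = exp (2 sup Re g) sin \<theta>\<close> in modulus, and the hypothesis is
  \<open>D < A\<close>. The delicate point of the disc step is uniformity, as the zeros may lie
  arbitrarily close to the rim. They then cluster, and the bad \<xi> fit into a smaller disc
  touching the old one from inside, whose radius does not depend on the depth of the zeros.
  Convergence of ratios says nothing about the size of \<open>N^n 1\<close>, so \<lambda> \<noteq> 0
  has its own argument, a lower bound for \<open>N\<close> on acute functions. Acuteness is demanded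
  at every point, hence bounded functions are treated without null sets, which enter only in the
  passage to \<open>L^p\<close>. On the kernel of \<ell> the Neumann series converges even at
  \<lambda>, whence algebraic simplicity.\<close>

lemma Re_mult_cnj_scale: "Re (a * w * cnj (b * w)) = Re (a * cnj b) * (cmod w)\<^sup>2"
  unfolding cmod_power2 by (simp add: power2_eq_square algebra_simps)

lemma Re_mult_cnj_self: "Re (z * cnj z) = (cmod z)\<^sup>2"
  unfolding cmod_power2 by (simp add: power2_eq_square)

lemma ex_unit_direction: "\<exists>w. cmod w = 1 \<and> z = of_real (cmod z) * w"
proof (cases "z = 0")
  case False
  then show ?thesis
    by (intro exI[of _ "z / of_real (cmod z)"]) (simp add: norm_divide)
qed (auto intro: exI[of _ 1])

text \<open>With \<open>m\<close> the larger modulus, the main term is at least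
  \<open>d m^2\<close>, while the error terms of the expanded product add up to at most
  \<open>(1/4 + 1/4 + 1/16) d m^2\<close>.\<close>

lemma Re_mult_cnj_pos_perturb:
  fixes p q p' q' :: complex
  assumes d: "0 < d" "d \<le> 1"
    and p: "d * (cmod p)\<^sup>2 \<le> Re (p * cnj q)" and q: "d * (cmod q)\<^sup>2 \<le> Re (p * cnj q)"
    and "p \<noteq> 0" and dp: "cmod (p' - p) \<le> d / 4 * cmod p" and dq: "cmod (q' - q) \<le> d / 4 * cmod q"
  shows "Re (p' * cnj q') > 0"
proof -
  define m where "m = max (cmod p) (cmod q)"
  have m: "m > 0" "cmod p \<le> m" "cmod q \<le> m" "d * m\<^sup>2 \<le> Re (p * cnj q)"
    using assms by (auto simp: m_def max_def)
  have dp': "cmod (p' - p) \<le> d / 4 * m" and dq': "cmod (q' - q) \<le> d / 4 * m"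
    using dp dq m d by (auto intro: order_trans mult_left_mono)
  have eq: "p' * cnj q' = p * cnj q + (p' - p) * cnj q + p * cnj (q' - q) + (p' - p) * cnj (q' - q)"
    by (simp add: algebra_simps)
  define Q where "Q = d * m\<^sup>2"
  have Q: "Q > 0" using d m by (simp add: Q_def)
  have le: "- cmod z \<le> Re z" for z :: complex
    using abs_Re_le_cmod[of z] unfolding abs_le_iff by simp
  have 1: "cmod ((p' - p) * cnj q) \<le> Q / 4"
  proof -
    have "cmod (p' - p) * cmod q \<le> (d / 4 * m) * m" using m dp' d by (intro mult_mono) auto
    then show ?thesis by (simp add: norm_mult Q_def power2_eq_square)
  qed
  have 2: "cmod (p * cnj (q' - q)) \<le> Q / 4"
  proof -
    have "cmod p * cmod (q' - q) \<le> m * (d / 4 * m)" using m dq' d by (intro mult_mono) auto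
    then show ?thesis unfolding norm_mult complex_mod_cnj by (simp add: Q_def power2_eq_square mult.left_commute)
  qed
  have 3: "cmod ((p' - p) * cnj (q' - q)) \<le> Q / 16"
  proof -
    have "cmod (p' - p) * cmod (q' - q) \<le> (d / 4 * m) * (d / 4 * m)"
      using m dp' dq' d by (intro mult_mono) auto
    also have "\<dots> = d * Q / 16" by (simp add: Q_def power2_eq_square)
    also have "\<dots> \<le> 1 * Q / 16" using d Q by (intro divide_right_mono mult_right_mono) auto
    finally show ?thesis unfolding norm_mult complex_mod_cnj by simp
  qed
  have "Re (p' * cnj q') = Re (p * cnj q) + Re ((p' - p) * cnj q) + Re (p * cnj (q' - q))
      + Re ((p' - p) * cnj (q' - q))"
    by (subst eq) (simp only: plus_complex.simps)
  moreover have "Q \<le> Re (p * cnj q)" using m(4) by (simp add: Q_def)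
  ultimately show ?thesis
    using le[of "(p' - p) * cnj q"] le[of "p * cnj (q' - q)"]
      le[of "(p' - p) * cnj (q' - q)"] 1 2 3 Q by linarith
qed

text \<open>The values are rotated until their lowest ray lies on the real axis. Multiplication by
  the conjugate of one value makes all real parts positive, so this ray is the infimum of the slopes
  \<open>Im / Re\<close>. The infimum need not be attained, hence a closed quarter plane.\<close>

lemma pairwise_acute_imp_quarter_plane:
  fixes f :: "'i \<Rightarrow> complex"
  assumes pos: "\<And>x y. Re (f x * cnj (f y)) > 0"
  obtains c where "cmod c = 1" "\<And>x. Re (c * f x) \<ge> 0" "\<And>x. Im (c * f x) \<ge> 0"
proof -
  define z where "z = f undefined"
  define F where "F x = f x * cnj z" for x
  have F_pos: "Re (F x) > 0" for x
    using pos[of x undefined] by (simp add: F_def z_def)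
  then have z0: "z \<noteq> 0" by (force simp: F_def)
  have FF: "Re (F x) * Re (F y) + Im (F x) * Im (F y) > 0" for x y
  proof -
    have "Re (F x * cnj (F y)) = Re (f x * cnj (f y)) * (cmod z)\<^sup>2"
      using Re_mult_cnj_scale[of "f x" "cnj z" "f y"] by (simp add: F_def)
    moreover have "\<dots> > 0" using pos[of x y] z0 by simp
    ultimately show ?thesis by simp
  qed
  have ex: "\<exists>c. c \<noteq> 0 \<and> (\<forall>x. Re (c * F x) \<ge> 0 \<and> Im (c * F x) \<ge> 0)"
  \<comment> \<open>Slopes unbounded below can occur only in the first case, where a quarter turn
    suffices. One positive slope bounds the others from below through
    \<open>1 + t x * t y > 0\<close>.\<close>
  proof (cases "\<forall>x. Im (F x) \<le> 0")
    case True
    then show ?thesis using F_pos by (intro exI[of _ \<i>]) (auto intro: less_imp_le)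
  next
    case False
    then obtain x1 where x1: "Im (F x1) > 0" by (auto simp: not_le)
    define t where "t x = Im (F x) / Re (F x)" for x
    have tt: "1 + t x * t y > 0" for x y
      using FF[of x y] F_pos[of x] F_pos[of y] by (simp add: t_def field_simps)
    have t1: "t x1 > 0" using x1 F_pos by (simp add: t_def)
    have bdd: "bdd_below (range t)"
    proof (rule bdd_belowI)
      fix y assume "y \<in> range t"
      then obtain w where "y = t w" by auto
      then show "- (1 / t x1) \<le> y" using tt[of x1 w] t1 by (simp add: field_simps)
    qed
    define s where "s = Inf (range t)"
    have s_le: "s \<le> t x" for x unfolding s_def using bdd by (auto intro: cInf_lower)
    have st: "1 + s * t x \<ge> 0" for x
    proof (cases "t x > 0")
      case True
      have "- (1 / t x) \<le> s" unfolding s_def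
      proof (rule cInf_greatest)
        fix y assume "y \<in> range t"
        then obtain w where "y = t w" by auto
        then show "- (1 / t x) \<le> y" using tt[of x w] True by (simp add: field_simps)
      qed auto
      then show ?thesis using True by (simp add: field_simps)
    next
      case False
      \<comment> \<open>The value at the reference point has slope 0.\<close>
      have "s \<le> 0" using s_le[of undefined] by (simp add: t_def F_def z_def)
      then show ?thesis using False by (simp add: mult_nonpos_nonpos add_nonneg_nonneg)
    qed
    have Im_eq: "Im (F x) = t x * Re (F x)" for x using F_pos[of x] by (simp add: t_def)
    have "Re (Complex 1 (- s) * F x) = (1 + s * t x) * Re (F x)"
         "Im (Complex 1 (- s) * F x) = (t x - s) * Re (F x)" for x
      by (simp_all add: Im_eq algebra_simps)
    then show ?thesis using st s_le F_pos
      by (intro exI[of _ "Complex 1 (- s)"]) (auto simp: complex_eq_iff less_imp_le)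
  qed
  then obtain c where c: "c \<noteq> 0" "\<And>x. Re (c * F x) \<ge> 0" "\<And>x. Im (c * F x) \<ge> 0" by blast
  define e where "e = c * cnj z"
  have e: "e \<noteq> 0" using c z0 by (simp add: e_def)
  have "sgn e * f x = inverse (cmod e) *\<^sub>R (c * F x)" for x
    by (simp add: sgn_div_norm e_def F_def scaleR_conv_of_real algebra_simps)
  then have "Re (sgn e * f x) = inverse (cmod e) * Re (c * F x)"
    "Im (sgn e * f x) = inverse (cmod e) * Im (c * F x)" for x by (simp_all only: scaleR_complex.simps)
  with c e show thesis by (intro that[of "sgn e"]) (auto simp: norm_sgn)
qed

text \<open>
  Chosen so that, for \<open>r = contr d\<close>, \<open>cmod u = 1\<close> and every \<open>e\<close>, the disc of radius \<open>1 - r\<close>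
  about \<open>r u\<close> contains the points of the unit disc that are within \<open>k1 e\<close> of \<open>(1 - e) u\<close> and
  farther than \<open>k2 e\<close> from the circle, where \<open>r = k2 / (2 (1 + k1))\<close>.
\<close>

definition contr :: "real \<Rightarrow> real" where
  "contr d = (d / (4 * (2 + 1 / d))) / (2 * (1 + 4 * (1 + 1 / d) / d))"

lemma contr_bounds: assumes "0 < d" "d \<le> 1" shows "0 < contr d" "contr d < 1"
proof -
  define p where "p = 4 * (2 + 1 / d)"
  define q where "q = 2 * (1 + 4 * (1 + 1 / d) / d)"
  have pq: "p > 1" "q > 1" using assms by (auto simp: p_def q_def add_pos_pos intro: add_strict_increasing)
  then have "1 < p * q" by (simp add: less_1_mult)
  then have "0 < d / (p * q)" "d / (p * q) < 1" using assms by (auto simp: divide_less_eq)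
  then show "0 < contr d" "contr d < 1" by (simp_all add: contr_def p_def q_def)
qed

text \<open>
  The zeros \<open>s x\<close> of \<open>\<xi> a x + b x\<close> lie in the unit disc and have comparable distances to the
  circle, of order \<open>e\<close>, and mutual distances at most of this order. The same then holds for the
  \<open>\<xi>\<close> at which the conclusion fails, by perturbing from \<open>a\<close> far from the zeros and from
  \<open>w a + b\<close>, \<open>w = \<xi> / |\<xi>|\<close>, near the circle.
\<close>

lemma disc_contraction:
  fixes a b :: "'i \<Rightarrow> complex"
  assumes d: "0 < d" "d \<le> 1"
    and a: "\<And>x y t. d * (cmod (a t))\<^sup>2 \<le> Re (a x * cnj (a y))"
    and a0: "\<And>x. a x \<noteq> 0"
    and F: "\<And>\<xi> x y t. cmod \<xi> \<ge> 1 \<Longrightarrow>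
      d * (cmod (\<xi> * a t + b t))\<^sup>2 \<le> Re ((\<xi> * a x + b x) * cnj (\<xi> * a y + b y))"
    and F0: "\<And>\<xi> x. cmod \<xi> \<ge> 1 \<Longrightarrow> \<xi> * a x + b x \<noteq> 0"
  obtains c where "cmod c \<le> contr d"
    "\<And>\<xi> x y. cmod (\<xi> - c) \<ge> 1 - contr d \<Longrightarrow> Re ((\<xi> * a x + b x) * cnj (\<xi> * a y + b y)) > 0"
proof -
  \<comment> \<open>\<open>k\<close> bounds the ratio of the distances from a point outside the disc
    to two zeros. \<open>k1\<close> and \<open>k2\<close> are sized so that the errors
    \<open>(1 + k) e\<close> and \<open>k2 e\<close> become the factor \<open>d / 4\<close> allowed
    in \<open>Re_mult_cnj_pos_perturb\<close>.\<close>
  define k where "k = 1 / d"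
  define k2 where "k2 = d / (4 * (2 + k))"
  define k1 where "k1 = 4 * (1 + k) / d"
  define s where "s x = - b x / a x" for x
  have k: "k > 0" and k1: "k1 > 0" and k2: "k2 > 0" "k2 < 1"
    using d mult_mono[of d 1 d 1] by (auto simp: k_def k1_def k2_def field_simps add_pos_pos)
  have F_eq: "\<xi> * a x + b x = a x * (\<xi> - s x)" for \<xi> x
    using a0[of x] by (simp add: s_def field_simps)
  have s_less: "cmod (s x) < 1" for x
    using F0[of "s x" x] by (force simp: F_eq)
  \<comment> \<open>A Harnack-type comparison: the moduli of \<open>\<xi> a + b\<close> at two
    points are comparable, so are those of \<open>a\<close>, and their quotient is the distance to
    the zero. Each comparison costs a factor \<open>d\<close> in the squares.\<close>
  have ratio: "cmod (\<xi> - s y) \<le> k * cmod (\<xi> - s x)" if "cmod \<xi> \<ge> 1" for \<xi> x y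
  proof -
    have 1: "d * (cmod (a y))\<^sup>2 * (cmod (\<xi> - s y))\<^sup>2 \<le> (cmod (a x))\<^sup>2 * (cmod (\<xi> - s x))\<^sup>2"
      using F[OF that, of y x x] unfolding F_eq Re_mult_cnj_self norm_mult power_mult_distrib
      by (simp add: mult.assoc)
    have 2: "d * (cmod (a x))\<^sup>2 \<le> (cmod (a y))\<^sup>2"
      using a[of x y y] unfolding Re_mult_cnj_self .
    have "(cmod (a x))\<^sup>2 * (d * cmod (\<xi> - s y))\<^sup>2 = d * (d * (cmod (a x))\<^sup>2) * (cmod (\<xi> - s y))\<^sup>2"
      by (simp add: power2_eq_square algebra_simps)
    also have "\<dots> \<le> d * (cmod (a y))\<^sup>2 * (cmod (\<xi> - s y))\<^sup>2"
      using 2 d by (intro mult_right_mono mult_left_mono) auto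
    also have "\<dots> \<le> (cmod (a x))\<^sup>2 * (cmod (\<xi> - s x))\<^sup>2" by (rule 1)
    finally have "(d * cmod (\<xi> - s y))\<^sup>2 \<le> (cmod (\<xi> - s x))\<^sup>2"
      using a0[of x] by (simp add: mult_le_cancel_left)
    then have "d * cmod (\<xi> - s y) \<le> cmod (\<xi> - s x)"
      using d by (simp add: power2_le_iff_abs_le abs_le_square_iff[symmetric])
    then show ?thesis using d by (simp add: k_def field_simps)
  qed
  \<comment> \<open>\<open>ratio\<close> is applied at the radial projection of \<open>s x\<close>
    to the circle, at distance \<open>1 - |s x|\<close> from \<open>s x\<close>.\<close>
  have near: "cmod (s x - s y) \<le> (1 + k) * (1 - cmod (s x))" for x y
  proof -
    obtain w where w: "cmod w = 1" "s x = of_real (cmod (s x)) * w" using ex_unit_direction by blast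
    have "w - s x = of_real (1 - cmod (s x)) * w" by (subst w(2)) (simp add: algebra_simps)
    then have "cmod (w - s x) = \<bar>1 - cmod (s x)\<bar>"
      using w(1) by (metis mult.right_neutral norm_mult norm_of_real)
    then have ws: "cmod (w - s x) = 1 - cmod (s x)" using s_less[of x] by simp
    have "cmod (s x - s y) \<le> cmod (w - s x) + cmod (w - s y)"
      using norm_triangle_ineq4[of "w - s y" "w - s x"] by simp
    also have "\<dots> \<le> cmod (w - s x) + k * cmod (w - s x)" using ratio[of w y x] w by simp
    finally show ?thesis by (simp add: ws algebra_simps)
  qed
  define s0 where "s0 = s undefined"
  define e where "e = 1 - cmod s0"
  have e: "e > 0" "e \<le> 1" using s_less by (auto simp: e_def s0_def)
  have s0: "cmod (s0 - s x) \<le> (1 + k) * e" for x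
    using near[of undefined x] by (simp add: s0_def e_def)
  have depth: "e / (2 + k) \<le> 1 - cmod (s x)" for x
  proof -
    have "e \<le> (1 - cmod (s x)) + cmod (s x - s0)"
      unfolding e_def using norm_triangle_ineq2[of "s x" s0] by linarith
    also have "\<dots> \<le> (1 - cmod (s x)) + (1 + k) * (1 - cmod (s x))"
      using near[of x undefined] by (simp add: s0_def)
    finally show ?thesis using k by (simp add: field_simps)
  qed
  have far: "Re ((\<xi> * a x + b x) * cnj (\<xi> * a y + b y)) > 0"
    if "cmod (\<xi> - s0) \<ge> k1 * e" for \<xi> x y
  proof -
    have nz: "\<xi> \<noteq> s0" using that k1 e by (auto simp: mult_le_0_iff)
    have dev: "cmod (\<xi> * a x + b x - a x * (\<xi> - s0)) \<le> d / 4 * cmod (a x * (\<xi> - s0))" for x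
    proof -
      have "cmod (\<xi> * a x + b x - a x * (\<xi> - s0)) = cmod (a x) * cmod (s0 - s x)"
        unfolding F_eq norm_mult[symmetric] by (simp add: algebra_simps)
      also have "\<dots> \<le> cmod (a x) * ((1 + k) * e)" by (intro mult_left_mono s0) auto
      also have "(1 + k) * e = d / 4 * (k1 * e)" using d by (simp add: k1_def)
      also have "cmod (a x) * \<dots> \<le> cmod (a x) * (d / 4 * cmod (\<xi> - s0))"
        using that d by (intro mult_left_mono) auto
      finally show ?thesis by (simp add: norm_mult mult.left_commute)
    qed
    have "d * (cmod (a t * (\<xi> - s0)))\<^sup>2 \<le> Re (a x * (\<xi> - s0) * cnj (a y * (\<xi> - s0)))" for t
      unfolding Re_mult_cnj_scale norm_mult power_mult_distrib using mult_right_mono[OF a[of t x y], of "(cmod (\<xi> - s0))\<^sup>2"]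
      by (simp add: mult.assoc)
    then show ?thesis
      using d dev a0 nz
      by (intro Re_mult_cnj_pos_perturb[where p = "a x * (\<xi> - s0)" and q = "a y * (\<xi> - s0)" and d = d]) auto
  qed
  have outer: "Re ((\<xi> * a x + b x) * cnj (\<xi> * a y + b y)) > 0" if "cmod \<xi> \<ge> 1" for \<xi> x y
  proof -
    have "0 < d * (cmod (\<xi> * a x + b x))\<^sup>2" using F0[OF that] d by simp
    also note F[OF that, of x x y]
    finally show ?thesis .
  qed
  have rim: "Re ((\<xi> * a x + b x) * cnj (\<xi> * a y + b y)) > 0"
    if "1 - cmod \<xi> \<le> k2 * e" "cmod \<xi> < 1" for \<xi> x y
  proof -
    obtain w where w: "cmod w = 1" "\<xi> = of_real (cmod \<xi>) * w" using ex_unit_direction by blast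
    have "w - \<xi> = of_real (1 - cmod \<xi>) * w" by (subst w(2)) (simp add: algebra_simps)
    then have "cmod (w - \<xi>) = \<bar>1 - cmod \<xi>\<bar>"
      using w(1) by (metis mult.right_neutral norm_mult norm_of_real)
    then have wx: "cmod (\<xi> - w) = 1 - cmod \<xi>" using that by (simp add: norm_minus_commute)
    have dev: "cmod (\<xi> * a x + b x - (w * a x + b x)) \<le> d / 4 * cmod (w * a x + b x)" for x
    proof -
      have "cmod (\<xi> * a x + b x - (w * a x + b x)) = cmod (a x) * (1 - cmod \<xi>)"
        unfolding wx[symmetric] norm_mult[symmetric] by (simp add: algebra_simps)
      also have "\<dots> \<le> cmod (a x) * (k2 * e)" using that by (intro mult_left_mono) auto
      also have "k2 * e = d / 4 * (e / (2 + k))" by (simp add: k2_def)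
      also have "cmod (a x) * \<dots> \<le> cmod (a x) * (d / 4 * (1 - cmod (s x)))"
        using d depth[of x] by (intro mult_left_mono) auto
      also have "\<dots> \<le> cmod (a x) * (d / 4 * cmod (w - s x))"
        using d norm_triangle_ineq2[of w "s x"] w by (intro mult_left_mono) auto
      finally show ?thesis unfolding F_eq norm_mult by (simp only: mult.left_commute)
    qed
    show ?thesis
      using d dev w F[of w] F0[of w]
      by (intro Re_mult_cnj_pos_perturb[where p = "w * a x + b x" and q = "w * a y + b y" and d = d]) auto
  qed
  obtain u where u: "cmod u = 1" "s0 = of_real (cmod s0) * u" using ex_unit_direction by blast
  define r where "r = contr d"
  have r_eq: "r = k2 / (2 * (1 + k1))" by (simp add: r_def contr_def k2_def k1_def k_def)
  have r: "0 < r" "r < 1" using contr_bounds[OF d] by (auto simp: r_def)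
  show thesis
  proof (rule that[of "of_real r * u"])
    show "cmod (of_real r * u) \<le> contr d" using u r by (simp add: norm_mult r_def)
    fix \<xi> x y assume asm: "cmod (\<xi> - of_real r * u) \<ge> 1 - contr d"
    show "Re ((\<xi> * a x + b x) * cnj (\<xi> * a y + b y)) > 0"
    proof (rule ccontr)
      assume neg: "\<not> ?thesis"
      have 1: "cmod \<xi> < 1" using neg outer[of \<xi> x y] not_le by blast
      have 2: "1 - cmod \<xi> > k2 * e" using neg rim[OF _ 1, of x y] not_le by blast
      have 3: "cmod (\<xi> - s0) < k1 * e" using neg far[of \<xi> x y] not_le by blast
      have uu: "u * cnj u = 1" using complex_norm_square[of u] u(1) by simp
      have Re_u: "Re (\<xi> * cnj u) \<ge> 1 - (1 + k1) * e"
      proof -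
        have "\<xi> * cnj u = of_real (cmod s0) * (u * cnj u) + (\<xi> - s0) * cnj u"
          using u(2) by (simp add: algebra_simps)
        then have "Re (\<xi> * cnj u) = cmod s0 + Re ((\<xi> - s0) * cnj u)" by (simp only: uu) simp
        moreover have "\<bar>Re ((\<xi> - s0) * cnj u)\<bar> \<le> k1 * e"
          using abs_Re_le_cmod[of "(\<xi> - s0) * cnj u"] 3 u by (simp add: norm_mult)
        ultimately show ?thesis by (simp add: e_def algebra_simps)
      qed
      have sq: "(cmod \<xi>)\<^sup>2 < 1 - k2 * e"
      proof -
        have "(cmod \<xi>)\<^sup>2 \<le> cmod \<xi>" using 1 by (simp add: power2_eq_square mult_left_le)
        then show ?thesis using 2 by linarith
      qed
      \<comment> \<open>The terms in \<open>e\<close> cancel because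
        \<open>2 r (1 + k1) = k2\<close>. This makes the new radius independent of how close the
        zeros are to the circle.\<close>
      have "(cmod (\<xi> - of_real r * u))\<^sup>2 = (cmod \<xi>)\<^sup>2 - 2 * r * Re (\<xi> * cnj u) + r\<^sup>2 * (cmod u)\<^sup>2"
        unfolding cmod_power2 by (simp add: power2_eq_square algebra_simps)
      also have "\<dots> < (1 - k2 * e) - 2 * r * (1 - (1 + k1) * e) + r\<^sup>2"
        using sq mult_left_mono[OF Re_u, of "2 * r"] r u(1) by (simp only: power_one) linarith
      also have "\<dots> = (1 - r)\<^sup>2 - e * (k2 - 2 * r * (1 + k1))" by (simp add: power2_eq_square algebra_simps)
      also have "k2 - 2 * r * (1 + k1) = 0" using k1 unfolding r_eq by (simp add: divide_simps)
      finally have "cmod (\<xi> - of_real r * u) < 1 - r"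
        using r by (simp add: power_less_imp_less_base)
      then show False using asm by (simp add: r_def)
    qed
  qed
qed

section \<open>Kernels with values in a sector\<close>

definition acute :: "('i \<Rightarrow> complex) \<Rightarrow> bool" where
  "acute f \<longleftrightarrow> (\<forall>x y. Re (f x * cnj (f y)) > 0)"

lemma acute_nonzero: "acute f \<Longrightarrow> f x \<noteq> 0"
  unfolding acute_def by (metis less_irrefl mult_zero_left zero_complex.sel(1))

lemma acute_const: "c \<noteq> 0 \<Longrightarrow> acute (\<lambda>_. c)"
  unfolding acute_def Re_mult_cnj_self by simp

lemma eq_0_if_geometric_bound:
  fixes X :: "'b::real_normed_vector"
  assumes "\<And>n::nat. norm X \<le> C * q ^ n" "0 \<le> q" "q < 1"
  shows "X = 0"
proof -
  have "(\<lambda>n. C * q ^ n) \<longlonglongrightarrow> C * 0"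
    using assms by (intro tendsto_intros LIMSEQ_realpow_zero) auto
  then have "norm X \<le> C * 0" using assms(1) by (intro LIMSEQ_le_const) auto
  then show ?thesis by simp
qed

text \<open>All bounds hold at every point of the type rather than almost everywhere, since
  acuteness and the discs are pointwise notions. The measure stands for \<open>h m d\<mu>\<close>,
  and \<open>D < A\<close> is the form taken by the hypothesis on \<theta> and \<Lambda>.\<close>

locale sector_kernel = finite_measure M for M :: "'a measure" +
  fixes k :: "'a \<Rightarrow> 'a \<Rightarrow> complex" and b A D :: real
  assumes k_measurable [measurable]: "case_prod k \<in> borel_measurable (M \<Otimes>\<^sub>M M)"
    and k_section [measurable]: "\<And>x. k x \<in> borel_measurable M"
    and k_bound: "\<And>x y. cmod (k x y) \<le> b"
    and k_Re: "\<And>x y x' y'. A \<le> Re (k x y * cnj (k x' y'))"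
    and k_Im: "\<And>x y x' y'. \<bar>Im (k x y * cnj (k x' y'))\<bar> \<le> D"
    and D_less_A: "D < A"
    and nonnull: "emeasure M (space M) \<noteq> 0"
begin

definition N :: "('a \<Rightarrow> complex) \<Rightarrow> 'a \<Rightarrow> complex" where
  "N f = (\<lambda>x. LINT y|M. k x y * f y)"

definition B :: "('a \<Rightarrow> complex) set" where
  "B = {f \<in> borel_measurable M. \<exists>R. \<forall>x. cmod (f x) \<le> R}"

abbreviation mass :: real where "mass \<equiv> measure M (space M)"

text \<open>Quotient of the lower bound \<open>(A - D) (U^2 + V^2)\<close> for the real parts and
  the upper bound \<open>2 b^2 (U^2 + V^2)\<close> for the squared moduli in
  \<open>N_acute\<close>.\<close>

definition \<delta> :: real where "\<delta> = (A - D) / (2 * b\<^sup>2)"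

lemma mass_pos: "mass > 0"
  using nonnull by (simp add: emeasure_eq_measure zero_less_measure_iff)

lemma D_nonneg: "0 \<le> D"
  using k_Im order_trans abs_ge_zero by blast

lemma A_pos: "0 < A"
  using D_nonneg D_less_A by simp

lemma A_le: "A \<le> b\<^sup>2"
proof -
  have "A \<le> (cmod (k x y))\<^sup>2" for x y using k_Re[of x y x y] unfolding Re_mult_cnj_self .
  also have "(cmod (k x y))\<^sup>2 \<le> b\<^sup>2" for x y using k_bound[of x y] by (intro power_mono) auto
  finally show ?thesis .
qed

lemma b_pos: "0 < b"
proof -
  have "0 \<le> b" using k_bound norm_ge_zero order_trans by blast
  moreover have "b \<noteq> 0" using A_pos A_le by auto
  ultimately show ?thesis by simp
qed

lemma delta: "0 < \<delta>" "\<delta> \<le> 1"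
  using A_le D_less_A D_nonneg A_pos b_pos by (auto simp: \<delta>_def field_simps)

lemma BI: "f \<in> borel_measurable M \<Longrightarrow> (\<And>x. cmod (f x) \<le> R) \<Longrightarrow> f \<in> B"
  by (auto simp: B_def)

lemma B_measurable [measurable_dest]: "f \<in> B \<Longrightarrow> f \<in> borel_measurable M"
  by (simp add: B_def)

lemma B_bound: assumes "f \<in> B" obtains R where "R > 0" "\<And>x. cmod (f x) \<le> R"
proof -
  obtain R where "\<And>x. cmod (f x) \<le> R" using assms by (auto simp: B_def)
  then show thesis by (intro that[of "max R 1"]) (auto simp: le_max_iff_disj)
qed

lemma B_const: "(\<lambda>_. c) \<in> B"
  by (rule BI[of _ "cmod c"]) auto

lemma B_lin: assumes f: "f \<in> B" and g: "g \<in> B" shows "(\<lambda>x. c * f x + d * g x) \<in> B"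
proof -
  obtain R S where R: "R > 0" "\<And>x. cmod (f x) \<le> R" and S: "S > 0" "\<And>x. cmod (g x) \<le> S"
    using B_bound f g by metis
  show ?thesis
  proof (rule BI)
    show "(\<lambda>x. c * f x + d * g x) \<in> borel_measurable M" using f g by measurable
    show "cmod (c * f x + d * g x) \<le> cmod c * R + cmod d * S" for x
      using R S by (intro order_trans[OF norm_triangle_ineq] add_mono) (auto simp: norm_mult intro: mult_left_mono)
  qed
qed

lemma B_integrable: assumes f: "f \<in> B" shows "integrable M f"
proof -
  obtain R where "\<And>x. cmod (f x) \<le> R" using B_bound[OF f] by blast
  with f show ?thesis by (intro integrable_const_bound[of _ R]) auto
qed

lemma B_k: assumes f: "f \<in> B" shows "(\<lambda>y. k x y * f y) \<in> B"
proof -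
  obtain R where R: "R > 0" "\<And>x. cmod (f x) \<le> R" using B_bound[OF f] by blast
  show ?thesis
    using f R b_pos k_bound by (intro BI[of _ "b * R"]) (auto simp: norm_mult intro: mult_mono)
qed

lemma N_bound:
  assumes f: "f \<in> borel_measurable M" and R: "\<And>x. cmod (f x) \<le> R"
  shows "cmod (N f x) \<le> b * mass * R"
proof -
  have "cmod (N f x) \<le> (LINT y|M. cmod (k x y * f y))" unfolding N_def by (rule integral_norm_bound)
  also have "\<dots> \<le> (LINT y|M. b * R)"
    using B_k[OF BI, OF f R] b_pos k_bound R
    by (intro integral_mono integrable_norm B_integrable) (auto simp: norm_mult intro: mult_mono)
  finally show ?thesis by (simp add: mult_ac)
qed

lemma N_B: assumes f: "f \<in> B" shows "N f \<in> B"
proof -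
  obtain R where R: "R > 0" "\<And>x. cmod (f x) \<le> R" using B_bound[OF f] by blast
  show ?thesis
  proof (rule BI)
    have [measurable]: "f \<in> borel_measurable M" using f by measurable
    show "N f \<in> borel_measurable M" unfolding N_def by measurable
    show "cmod (N f x) \<le> b * mass * R" for x using f R by (intro N_bound) auto
  qed
qed

lemma N_lin:
  assumes "f \<in> B" "g \<in> B"
  shows "N (\<lambda>x. c * f x + d * g x) = (\<lambda>x. c * N f x + d * N g x)"
proof
  fix x
  have "N (\<lambda>x. c * f x + d * g x) x = (LINT y|M. c * (k x y * f y) + d * (k x y * g y))"
    unfolding N_def by (simp add: algebra_simps)
  also have "\<dots> = c * N f x + d * N g x"
    unfolding N_def using assms by (simp add: B_integrable B_k)
  finally show "N (\<lambda>x. c * f x + d * g x) x = c * N f x + d * N g x" .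
qed

lemma N_scale: "f \<in> B \<Longrightarrow> N (\<lambda>x. c * f x) = (\<lambda>x. c * N f x)"
  using N_lin[of f "\<lambda>_. 0" c 0] by (simp add: B_const)

section \<open>Images of acute functions\<close>

text \<open>The double integral of \<open>Re (\<epsilon> * k x s * cnj (k y t)) * u s * v t\<close>,
  taken as two single integrals. The phase \<epsilon> is 1 for diagonal terms and
  \<open>\<i>\<close> or \<open>- \<i>\<close> for cross terms, where it turns imaginary parts into
  real ones.\<close>

lemma Re_product_integrals_ge:
  assumes u: "(\<lambda>x. of_real (u x)) \<in> B" "\<And>x. 0 \<le> u x"
    and v: "(\<lambda>x. of_real (v x)) \<in> B" "\<And>x. 0 \<le> v x"
    and lo: "\<And>s t. lo \<le> Re (\<epsilon> * k x s * cnj (k y t))"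
  shows "lo * (LINT s|M. u s) * (LINT t|M. v t)
    \<le> Re (\<epsilon> * N (\<lambda>s. of_real (u s)) x * cnj (N (\<lambda>t. of_real (v t)) y))"
proof -
  have ui: "integrable M u" and vi: "integrable M v"
    using B_integrable[OF u(1)] B_integrable[OF v(1)] by (simp_all add: complex_of_real_integrable_eq)
  let ?P = "N (\<lambda>t. of_real (v t)) y"
  have int: "integrable M (\<lambda>t. \<epsilon> * k x s * cnj (k y t * of_real (v t)))" for s
    using B_integrable[OF B_k[OF v(1)], of y] by (intro integrable_mult_right) (simp only: complex_integrable_cnj)
  have pw: "Re (\<epsilon> * k x s * cnj (k y t * of_real (v t))) = Re (\<epsilon> * k x s * cnj (k y t)) * v t" for s t
    by (simp add: algebra_simps)
  have inner: "lo * (LINT t|M. v t) \<le> Re (\<epsilon> * k x s * cnj ?P)" for s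
  proof -
    have "cnj ?P = (LINT t|M. cnj (k y t * of_real (v t)))"
      using Bochner_Integration.integral_cnj[of M "\<lambda>t. k y t * of_real (v t)"] by (simp only: N_def)
    then have "Re (\<epsilon> * k x s * cnj ?P) = Re (LINT t|M. \<epsilon> * k x s * cnj (k y t * of_real (v t)))"
      by (simp only: integral_mult_right_zero)
    also have "\<dots> = (LINT t|M. Re (\<epsilon> * k x s * cnj (k y t * of_real (v t))))"
      by (intro integral_Re[symmetric] int)
    also have "\<dots> = (LINT t|M. Re (\<epsilon> * k x s * cnj (k y t)) * v t)"
      by (simp only: pw)
    also have "\<dots> \<ge> (LINT t|M. lo * v t)"
      using vi v lo integrable_Re[OF int] unfolding pw by (intro integral_mono) (auto intro: mult_right_mono)
    finally show ?thesis by simp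
  qed
  let ?V = "LINT t|M. v t"
  have int2: "integrable M (\<lambda>s. k x s * of_real (u s) * (\<epsilon> * cnj ?P))"
    using B_integrable[OF B_k[OF u(1)], of x] by (intro integrable_mult_left)
  have pw2: "Re (k x s * of_real (u s) * (\<epsilon> * cnj ?P)) = Re (\<epsilon> * k x s * cnj ?P) * u s" for s
    by (simp add: algebra_simps)
  have "N (\<lambda>s. of_real (u s)) x * (\<epsilon> * cnj ?P) = (LINT s|M. k x s * of_real (u s) * (\<epsilon> * cnj ?P))"
    by (subst N_def) (simp only: integral_mult_left_zero)
  moreover have "\<epsilon> * N (\<lambda>s. of_real (u s)) x * cnj ?P = N (\<lambda>s. of_real (u s)) x * (\<epsilon> * cnj ?P)"
    by (simp only: mult_ac)
  ultimately have "Re (\<epsilon> * N (\<lambda>s. of_real (u s)) x * cnj ?P) = Re (LINT s|M. k x s * of_real (u s) * (\<epsilon> * cnj ?P))"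
    by (simp only:)
  also have "\<dots> = (LINT s|M. Re (k x s * of_real (u s) * (\<epsilon> * cnj ?P)))"
    by (intro integral_Re[symmetric] int2)
  also have "\<dots> = (LINT s|M. Re (\<epsilon> * k x s * cnj ?P) * u s)"
    by (simp only: pw2)
  also have "\<dots> \<ge> (LINT s|M. lo * ?V * u s)"
    using ui u inner integrable_Re[OF int2] unfolding pw2 by (intro integral_mono) (auto intro: mult_right_mono)
  finally show ?thesis by (simp add: mult_ac)
qed

lemma N_nonneg_bound:
  assumes u: "(\<lambda>x. of_real (u x)) \<in> B" "\<And>x. 0 \<le> u x"
  shows "cmod (N (\<lambda>s. of_real (u s)) x) \<le> b * (LINT s|M. u s)"
proof -
  have "cmod (N (\<lambda>s. of_real (u s)) x) \<le> (LINT y|M. cmod (k x y * of_real (u y)))"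
    unfolding N_def by (rule integral_norm_bound)
  also have "\<dots> \<le> (LINT y|M. b * u y)"
    using B_integrable[OF B_k[OF u(1)], of x] B_integrable[OF u(1)] u k_bound
    by (intro integral_mono integrable_norm)
      (auto simp: norm_mult complex_of_real_integrable_eq intro: mult_right_mono)
  finally show ?thesis by simp
qed

text \<open>Every bound passes through \<open>U^2 + V^2\<close>, the squared modulus of the integral
  of \<open>f\<close>. It dominates a fixed multiple of each \<open>|N f t|^2\<close>, so acuteness
  becomes uniform; the second bound is a source of the lower bound for the iterates
  \<open>E\<close>.\<close>

lemma N_acute:
  assumes f: "f \<in> B" and acute: "acute f"
  shows "\<delta> * (cmod (N f t))\<^sup>2 \<le> Re (N f x * cnj (N f y))"
    and "(A - D) * (cmod (LINT s|M. f s))\<^sup>2 \<le> Re (N f x * cnj (N f y))"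
    and "N f x \<noteq> 0"
proof -
  obtain c where c: "cmod c = 1" and re: "\<And>x. Re (c * f x) \<ge> 0" and im: "\<And>x. Im (c * f x) \<ge> 0"
    using pairwise_acute_imp_quarter_plane[of f] acute unfolding acute_def by blast
  define u where "u x = Re (c * f x)" for x
  define v where "v x = Im (c * f x)" for x
  obtain R where R: "R > 0" "\<And>x. cmod (f x) \<le> R" using B_bound[OF f] by blast
  have cR: "cmod (c * f x) \<le> R" for x using R c by (simp add: norm_mult)
  have uB: "(\<lambda>x. of_real (u x)) \<in> B"
    using f cR by (intro BI[of _ R]) (auto simp: u_def simp del: times_complex.sel intro: order_trans[OF abs_Re_le_cmod])
  have vB: "(\<lambda>x. of_real (v x)) \<in> B"
    using f cR by (intro BI[of _ R]) (auto simp: v_def simp del: times_complex.sel intro: order_trans[OF abs_Im_le_cmod])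
  have u0: "0 \<le> u x" and v0: "0 \<le> v x" for x using re im by (auto simp: u_def v_def)
  have ui: "integrable M u" and vi: "integrable M v"
    using B_integrable[OF uB] B_integrable[OF vB] by (simp_all add: complex_of_real_integrable_eq)
  define U where "U = (LINT s|M. u s)"
  define V where "V = (LINT s|M. v s)"
  have UV0: "U \<ge> 0" "V \<ge> 0" using u0 v0 by (auto simp: U_def V_def)
  define p where "p = N (\<lambda>s. of_real (u s))"
  define r where "r = N (\<lambda>s. of_real (v s))"
  have cf: "c * f x = of_real (u x) + \<i> * of_real (v x)" for x
    unfolding u_def v_def using complex_eq[of "c * f x"] by simp
  have "N (\<lambda>x. c * f x) = (\<lambda>x. p x + \<i> * r x)"
    unfolding cf p_def r_def using N_lin[OF uB vB, of 1 \<i>] by simp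
  then have cN: "c * N f x = p x + \<i> * r x" for x
    using N_scale[OF f, of c] by (metis)
  have cc: "c * cnj c = 1" using complex_norm_square[of c] c by simp
  have NN: "Re (N f x * cnj (N f y)) \<ge> (A - D) * (U\<^sup>2 + V\<^sup>2)" for x y
    \<comment> \<open>The diagonal terms contribute \<open>A (U\<^sup>2 + V\<^sup>2)\<close>, the cross terms at least \<open>- 2 D U V\<close>.\<close>
  proof -
    have "N f x * cnj (N f y) = (c * cnj c) * (N f x * cnj (N f y))" by (simp add: cc)
    also have "\<dots> = (c * N f x) * cnj (c * N f y)" by simp
    also have "\<dots> = 1 * p x * cnj (p y) + 1 * r x * cnj (r y) + \<i> * r x * cnj (p y) + (- \<i>) * p x * cnj (r y)"
      unfolding cN by (simp add: algebra_simps)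
    finally have "Re (N f x * cnj (N f y)) = Re (1 * p x * cnj (p y)) + Re (1 * r x * cnj (r y))
        + Re (\<i> * r x * cnj (p y)) + Re ((- \<i>) * p x * cnj (r y))"
      by (simp only: plus_complex.sel)
    moreover have "A * U * U \<le> Re (1 * p x * cnj (p y))"
      unfolding U_def p_def using k_Re by (intro Re_product_integrals_ge uB u0) simp
    moreover have "A * V * V \<le> Re (1 * r x * cnj (r y))"
      unfolding V_def r_def using k_Re by (intro Re_product_integrals_ge vB v0) simp
    moreover have "(- D) * V * U \<le> Re (\<i> * r x * cnj (p y))"
    proof -
      have "- D \<le> Re (\<i> * k x s * cnj (k y t))" for s t
        using k_Im[of x s y t] by (simp add: abs_le_iff mult.assoc)
      then show ?thesis unfolding U_def V_def p_def r_def by (intro Re_product_integrals_ge uB u0 vB v0)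
    qed
    moreover have "(- D) * U * V \<le> Re ((- \<i>) * p x * cnj (r y))"
    proof -
      have "- D \<le> Re ((- \<i>) * k x s * cnj (k y t))" for s t
        using k_Im[of x s y t] by (simp add: abs_le_iff mult.assoc)
      then show ?thesis unfolding U_def V_def p_def r_def by (intro Re_product_integrals_ge uB u0 vB v0)
    qed
    moreover have "D * (2 * U * V) \<le> D * (U\<^sup>2 + V\<^sup>2)"
      using D_nonneg sum_squares_bound[of U V] by (intro mult_left_mono) auto
    ultimately show ?thesis by (simp add: power2_eq_square algebra_simps)
  qed
  have "(LINT s|M. c * f s) = of_real U + \<i> * of_real V"
    unfolding cf U_def V_def using B_integrable[OF uB] B_integrable[OF vB] by simp
  then have "c * (LINT s|M. f s) = Complex U V"
    by (simp add: complex_eq_iff)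
  then have "cmod (LINT s|M. f s) = cmod (Complex U V)" using c by (metis norm_mult mult_1)
  then show "(A - D) * (cmod (LINT s|M. f s))\<^sup>2 \<le> Re (N f x * cnj (N f y))"
    using NN[of x y] by (simp add: cmod_power2)
  have up: "(cmod (N f t))\<^sup>2 \<le> 2 * b\<^sup>2 * (U\<^sup>2 + V\<^sup>2)" for t
  proof -
    have "cmod (N f t) = cmod (c * N f t)" using c by (simp add: norm_mult)
    also have "\<dots> \<le> cmod (p t) + cmod (r t)" unfolding cN by (metis norm_triangle_ineq norm_mult norm_ii mult_1)
    also have "\<dots> \<le> b * U + b * V"
      unfolding p_def r_def U_def V_def by (intro add_mono N_nonneg_bound uB vB u0 v0)
    finally have "(cmod (N f t))\<^sup>2 \<le> (b * U + b * V)\<^sup>2" by (intro power_mono) auto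
    also have "\<dots> = b\<^sup>2 * (U\<^sup>2 + V\<^sup>2 + 2 * U * V)" by (simp add: power2_eq_square algebra_simps)
    also have "\<dots> \<le> b\<^sup>2 * (2 * (U\<^sup>2 + V\<^sup>2))"
      using sum_squares_bound[of U V] by (intro mult_left_mono) auto
    finally show ?thesis by (simp add: algebra_simps)
  qed
  have "\<delta> * (cmod (N f t))\<^sup>2 \<le> \<delta> * (2 * b\<^sup>2 * (U\<^sup>2 + V\<^sup>2))"
    using delta up by (intro mult_left_mono) auto
  also have "\<dots> = (A - D) * (U\<^sup>2 + V\<^sup>2)" using b_pos by (simp add: \<delta>_def)
  also note NN[of x y]
  finally show "\<delta> * (cmod (N f t))\<^sup>2 \<le> Re (N f x * cnj (N f y))" .
  \<comment> \<open>Otherwise \<open>f\<close> would vanish almost everywhere, but an acute function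
    has no zeros and the space is not null.\<close>
  have "U + V \<noteq> 0"
  proof
    assume "U + V = 0"
    then have "(LINT s|M. u s + v s) = 0" using ui vi by (simp add: U_def V_def)
    then have "AE s in M. u s + v s = 0"
      using ui vi u0 v0 by (subst (asm) integral_nonneg_eq_0_iff_AE) auto
    then have "AE s in M. False"
    proof eventually_elim
      case (elim s)
      then have "u s = 0" "v s = 0" using u0[of s] v0[of s] by auto
      then have "c * f s = 0" by (simp add: cf)
      then show False using c acute_nonzero[OF acute] by auto
    qed
    then show False using nonnull ae_filter_eq_bot_iff[of M] by (simp add: trivial_limit_def)
  qed
  then have "U\<^sup>2 + V\<^sup>2 > 0" by (metis add.right_neutral sum_power2_gt_zero_iff)
  then have "0 < Re (N f x * cnj (N f x))"
    using NN[of x x] D_less_A by (smt (verit) mult_pos_pos)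
  then show "N f x \<noteq> 0" by auto
qed

lemma acute_N: assumes "f \<in> B" "acute f" shows "acute (N f)"
  unfolding acute_def
proof (intro allI)
  fix x y
  have "0 < \<delta> * (cmod (N f x))\<^sup>2" using N_acute(3)[OF assms] delta by simp
  also note N_acute(1)[OF assms]
  finally show "0 < Re (N f x * cnj (N f y))" .
qed

section \<open>Contraction of discs and convergence of ratios\<close>

definition \<tau> :: real where "\<tau> = contr \<delta>"
definition \<eta> :: real where "\<eta> = 1 - \<tau>"

lemma eta: "0 < \<eta>" "\<eta> < 1"
  using contr_bounds[OF delta] by (auto simp: \<eta>_def \<tau>_def)

text \<open>The map \<open>\<xi> \<mapsto> R \<xi> + c\<close> reduces this to the unit disc. Off
  the old disc \<open>N\<close> receives acute functions and returns functions acute with constant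
  \<open>\<delta>\<close>, as \<open>disc_contraction\<close> demands. The bound on the new centre
  keeps the new disc inside the old one.\<close>

lemma N_contracts_discs:
  assumes f: "f \<in> B" "acute f" and g: "g \<in> B" and R: "R > 0"
    and disc: "\<And>\<xi>. cmod (\<xi> - c) \<ge> R \<Longrightarrow> acute (\<lambda>x. \<xi> * f x + g x)"
  shows "\<exists>c'. cmod (c' - c) \<le> (1 - \<eta>) * R \<and>
    (\<forall>\<xi>. cmod (\<xi> - c') \<ge> \<eta> * R \<longrightarrow> acute (\<lambda>x. \<xi> * N f x + N g x))"
proof -
  let ?a = "\<lambda>x. of_real R * N f x" and ?b = "\<lambda>x. c * N f x + N g x"
  have N_eq: "N (\<lambda>x. \<xi> * f x + g x) = (\<lambda>x. \<xi> * N f x + N g x)" for \<xi>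
    using N_lin[OF f(1) g, of \<xi> 1] by simp
  have B: "(\<lambda>x. \<xi> * f x + g x) \<in> B" for \<xi> using B_lin[OF f(1) g, of \<xi> 1] by simp
  have ab: "\<xi> * ?a x + ?b x = N (\<lambda>x. (of_real R * \<xi> + c) * f x + g x) x" for \<xi> x
    unfolding N_eq by (simp add: algebra_simps)
  have ac: "acute (\<lambda>x. (of_real R * \<xi> + c) * f x + g x)" if "cmod \<xi> \<ge> 1" for \<xi>
    using that R by (intro disc) (simp add: norm_mult)
  obtain c' where c': "cmod c' \<le> contr \<delta>"
    "\<And>\<xi> x y. cmod (\<xi> - c') \<ge> 1 - contr \<delta> \<Longrightarrow> Re ((\<xi> * ?a x + ?b x) * cnj (\<xi> * ?a y + ?b y)) > 0"
  proof (rule disc_contraction[of \<delta> ?a ?b])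
    show "\<delta> * (cmod (of_real R * N f t))\<^sup>2 \<le> Re (of_real R * N f x * cnj (of_real R * N f y))" for x y t
    proof -
      have "of_real R * N f x * cnj (of_real R * N f y) = of_real (R\<^sup>2) * (N f x * cnj (N f y))"
        by (simp add: power2_eq_square)
      then have "Re (of_real R * N f x * cnj (of_real R * N f y)) = R\<^sup>2 * Re (N f x * cnj (N f y))"
        by (simp only: Re_complex_of_real Im_complex_of_real times_complex.sel)
      moreover have "(cmod (of_real R * N f t))\<^sup>2 = R\<^sup>2 * (cmod (N f t))\<^sup>2"
        by (simp add: norm_mult power_mult_distrib)
      ultimately show ?thesis
        using mult_left_mono[OF N_acute(1)[OF f, of t x y], of "R\<^sup>2"]
        by (simp only: mult.left_commute) simp
    qed
    show "of_real R * N f x \<noteq> 0" for x using N_acute(3)[OF f] R by simp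
    show "\<delta> * (cmod (\<xi> * ?a t + ?b t))\<^sup>2 \<le> Re ((\<xi> * ?a x + ?b x) * cnj (\<xi> * ?a y + ?b y))"
      if "1 \<le> cmod \<xi>" for \<xi> x y t unfolding ab by (rule N_acute(1)[OF B ac[OF that]])
    show "\<xi> * ?a x + ?b x \<noteq> 0" if "1 \<le> cmod \<xi>" for \<xi> x
      unfolding ab by (rule N_acute(3)[OF B ac[OF that]])
  qed (use delta in auto)
  show ?thesis
  proof (intro exI[of _ "c + of_real R * c'"] conjI allI impI)
    show "cmod (c + of_real R * c' - c) \<le> (1 - \<eta>) * R"
      using c'(1) R by (simp add: norm_mult \<eta>_def \<tau>_def mult.commute)
    fix \<xi> assume xi: "\<eta> * R \<le> cmod (\<xi> - (c + of_real R * c'))"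
    define z where "z = (\<xi> - c) / of_real R"
    have z: "\<xi> = of_real R * z + c" using R by (simp add: z_def)
    have "\<xi> - (c + of_real R * c') = of_real R * (z - c')" by (simp add: z algebra_simps)
    then have "\<eta> * R \<le> cmod (z - c') * R" using xi R by (simp add: norm_mult mult.commute)
    then have "1 - contr \<delta> \<le> cmod (z - c')" using R by (simp add: \<eta>_def \<tau>_def)
    from c'(2)[OF this] have "acute (N (\<lambda>x. \<xi> * f x + g x))" unfolding ab acute_def z by blast
    then show "acute (\<lambda>x. \<xi> * N f x + N g x)" by (simp only: N_eq)
  qed
qed

abbreviation E :: "nat \<Rightarrow> 'a \<Rightarrow> complex" where "E n \<equiv> (N ^^ n) (\<lambda>_. 1)"

lemma funpow_N_B: "f \<in> B \<Longrightarrow> (N ^^ n) f \<in> B"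
  by (induction n) (auto intro: N_B)

lemma funpow_N_lin:
  assumes "f \<in> B" "g \<in> B"
  shows "(N ^^ n) (\<lambda>x. c * f x + d * g x) = (\<lambda>x. c * (N ^^ n) f x + d * (N ^^ n) g x)"
  by (induction n) (use assms in \<open>auto simp: N_lin funpow_N_B\<close>)

lemma E_B: "E n \<in> B"
  by (intro funpow_N_B B_const)

lemma E_acute: "acute (E n)"
  by (induction n) (auto intro: acute_N E_B acute_const)

lemma E_nonzero: "E n x \<noteq> 0"
  by (rule acute_nonzero[OF E_acute])

text \<open>
  The contracting discs contain all values of \<open>- N\<^sup>n g / N\<^sup>n 1\<close>, since an acute function has no zeros.
\<close>

lemma ratio_convergence:
  assumes g: "g \<in> B" and R: "R > 0" "\<And>x. cmod (g x) \<le> R"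
  shows "\<exists>L. \<forall>n x. cmod ((N ^^ n) g x - L * E n x) \<le> 8 * R * \<eta> ^ n * cmod (E n x)"
proof -
  define P where "P n c \<longleftrightarrow> (\<forall>\<xi>. cmod (\<xi> - c) \<ge> 4 * R * \<eta> ^ n \<longrightarrow> acute (\<lambda>x. \<xi> * E n x + (N ^^ n) g x))"
    for n c
  \<comment> \<open>From \<open>|\<xi>| = 4 R\<close> on, \<open>g\<close> is at most a quarter of
    \<xi>, so the perturbation lemma applies with \<open>d = 1\<close>.\<close>
  have P0: "P 0 0"
    unfolding P_def
  proof (intro allI impI)
    fix \<xi> assume "4 * R * \<eta> ^ 0 \<le> cmod (\<xi> - 0)"
    then have xi: "4 * R \<le> cmod \<xi>" by simp
    have gx: "cmod (g x) \<le> 1 / 4 * cmod \<xi>" for x using xi R(2)[of x] by simp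
    show "acute (\<lambda>x. \<xi> * E 0 x + (N ^^ 0) g x)"
      unfolding acute_def
    proof (intro allI)
      fix x y
      show "0 < Re ((\<xi> * E 0 x + (N ^^ 0) g x) * cnj (\<xi> * E 0 y + (N ^^ 0) g y))"
        using xi R(1) gx by (intro Re_mult_cnj_pos_perturb[where p = \<xi> and q = \<xi> and d = 1])
          (auto simp: Re_mult_cnj_self simp del: times_complex.sel)
    qed
  qed
  have step: "\<exists>c'. P (Suc n) c' \<and> cmod (c' - c) \<le> 4 * R * \<eta> ^ n - 4 * R * \<eta> ^ Suc n" if "P n c" for n c
  proof -
    have "\<exists>c'. cmod (c' - c) \<le> (1 - \<eta>) * (4 * R * \<eta> ^ n) \<and>
      (\<forall>\<xi>. cmod (\<xi> - c') \<ge> \<eta> * (4 * R * \<eta> ^ n) \<longrightarrow> acute (\<lambda>x. \<xi> * N (E n) x + N ((N ^^ n) g) x))"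
      using that R eta by (intro N_contracts_discs E_B E_acute funpow_N_B g) (auto simp: P_def)
    moreover have "(1 - \<eta>) * (4 * R * \<eta> ^ n) = 4 * R * \<eta> ^ n - 4 * R * \<eta> ^ Suc n"
      "\<eta> * (4 * R * \<eta> ^ n) = 4 * R * \<eta> ^ Suc n" by (simp_all add: algebra_simps)
    ultimately show ?thesis by (auto simp: P_def)
  qed
  obtain c where c: "\<And>n. P n (c n)" "\<And>n. cmod (c (Suc n) - c n) \<le> 4 * R * \<eta> ^ n - 4 * R * \<eta> ^ Suc n"
  proof -
    have "\<exists>c. \<forall>n. P n (c n) \<and> cmod (c (Suc n) - c n) \<le> 4 * R * \<eta> ^ n - 4 * R * \<eta> ^ Suc n"
      by (rule dependent_nat_choice) (use P0 step in auto)
    then show ?thesis using that by blast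
  qed
  \<comment> \<open>The centre moves by at most the loss of radius, and these losses
    telescope.\<close>
  have dist: "cmod (c (n + m) - c n) \<le> 4 * R * \<eta> ^ n - 4 * R * \<eta> ^ (n + m)" for n m
  proof (induction m)
    case (Suc m)
    have "cmod (c (n + Suc m) - c n) \<le> cmod (c (Suc (n + m)) - c (n + m)) + cmod (c (n + m) - c n)"
      using norm_triangle_ineq[of "c (Suc (n + m)) - c (n + m)" "c (n + m) - c n"] by simp
    then show ?case using c(2)[of "n + m"] Suc by simp
  qed simp
  have dist': "cmod (c m - c n) \<le> 4 * R * \<eta> ^ n" if "n \<le> m" for m n
  proof -
    have "0 \<le> 4 * R * \<eta> ^ m" using R eta by simp
    then show ?thesis using dist[of n "m - n"] that by simp
  qed
  have "Cauchy c"
  proof (rule metric_CauchyI)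
    fix e :: real assume "e > 0"
    have "(\<lambda>n. 4 * R * \<eta> ^ n) \<longlonglongrightarrow> 4 * R * 0"
      using eta by (intro tendsto_intros LIMSEQ_realpow_zero) auto
    then have "\<forall>\<^sub>F n in sequentially. 4 * R * \<eta> ^ n < e / 2"
      using \<open>e > 0\<close> by (intro order_tendstoD) auto
    then obtain n where n: "4 * R * \<eta> ^ n < e / 2" by (auto simp: eventually_sequentially)
    have "dist (c i) (c j) < e" if "i \<ge> n" "j \<ge> n" for i j
      using dist'[OF that(1)] dist'[OF that(2)] n dist_triangle2[of "c i" "c j" "c n"]
      by (simp add: dist_norm)
    then show "\<exists>n. \<forall>i\<ge>n. \<forall>j\<ge>n. dist (c i) (c j) < e" by blast
  qed
  then obtain l where l: "c \<longlonglongrightarrow> l" by (auto simp: Cauchy_convergent_iff convergent_def)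
  have lc: "cmod (l - c n) \<le> 4 * R * \<eta> ^ n" for n
  proof (rule LIMSEQ_le_const2)
    show "(\<lambda>m. cmod (c m - c n)) \<longlonglongrightarrow> cmod (l - c n)" by (intro tendsto_intros l)
  qed (use dist' in auto)
  \<comment> \<open>The centres follow the zeros \<open>s\<close>, which are the negative ratios;
    hence the sign of \<open>l\<close>. Both \<open>l\<close> and \<open>s\<close> lie within
    \<open>4 R \<eta>^n\<close> of \<open>c n\<close>, which accounts for the 8.\<close>
  have "cmod ((N ^^ n) g x - (- l) * E n x) \<le> 8 * R * \<eta> ^ n * cmod (E n x)" for n x
  proof -
    define s where "s = - (N ^^ n) g x / E n x"
    have s: "(N ^^ n) g x = - s * E n x" using E_nonzero by (simp add: s_def)
    have "cmod (s - c n) < 4 * R * \<eta> ^ n"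
    proof (rule ccontr)
      assume "\<not> ?thesis"
      then have "acute (\<lambda>x. s * E n x + (N ^^ n) g x)" using c(1)[of n] by (auto simp: P_def)
      from acute_nonzero[OF this, of x] show False by (simp add: s)
    qed
    then have "cmod (l - s) \<le> 8 * R * \<eta> ^ n"
      using lc[of n] norm_triangle_ineq4[of "l - c n" "s - c n"] by simp
    moreover have "(N ^^ n) g x - (- l) * E n x = (l - s) * E n x" by (simp add: s algebra_simps)
    ultimately show ?thesis by (simp add: norm_mult mult_right_mono)
  qed
  then show ?thesis by blast
qed

text \<open>
  The limit is the same at every point, so an arbitrary one serves to define it.
\<close>

definition ell :: "('a \<Rightarrow> complex) \<Rightarrow> complex" where
  "ell g = lim (\<lambda>n. (N ^^ n) g undefined / E n undefined)"

lemma ell_unique: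
  assumes "\<And>n. cmod ((N ^^ n) g undefined - L * E n undefined) \<le> C * \<eta> ^ n * cmod (E n undefined)"
  shows "(\<lambda>n. (N ^^ n) g undefined / E n undefined) \<longlonglongrightarrow> L"
proof -
  have "(\<lambda>n. (N ^^ n) g undefined / E n undefined - L) \<longlonglongrightarrow> 0"
  proof (rule Lim_null_comparison)
    have "cmod ((N ^^ n) g undefined / E n undefined - L) \<le> C * \<eta> ^ n" for n
    proof -
      have "(N ^^ n) g undefined / E n undefined - L = ((N ^^ n) g undefined - L * E n undefined) / E n undefined"
        using E_nonzero[of n undefined] by (simp add: diff_divide_distrib)
      then show ?thesis using assms[of n] E_nonzero[of n undefined] by (simp add: norm_divide divide_simps)
    qed
    then show "\<forall>\<^sub>F n in sequentially. cmod ((N ^^ n) g undefined / E n undefined - L) \<le> C * \<eta> ^ n" by simp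
    have "(\<lambda>n. C * \<eta> ^ n) \<longlonglongrightarrow> C * 0"
      using eta by (intro tendsto_intros LIMSEQ_realpow_zero) auto
    then show "(\<lambda>n. C * \<eta> ^ n) \<longlonglongrightarrow> 0" by simp
  qed
  then show ?thesis by (simp add: LIM_zero_iff)
qed

lemma ell_tendsto: assumes "g \<in> B" shows "(\<lambda>n. (N ^^ n) g undefined / E n undefined) \<longlonglongrightarrow> ell g"
proof -
  obtain R where R: "R > 0" "\<And>x. cmod (g x) \<le> R" using B_bound[OF assms] by blast
  obtain L where L: "\<forall>n x. cmod ((N ^^ n) g x - L * E n x) \<le> 8 * R * \<eta> ^ n * cmod (E n x)"
    using ratio_convergence[OF assms R] ..
  have *: "(\<lambda>n. (N ^^ n) g undefined / E n undefined) \<longlonglongrightarrow> L" by (rule ell_unique[OF L[rule_format]])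
  show ?thesis unfolding ell_def limI[OF *] by (rule *)
qed

lemma ell_bound:
  assumes "g \<in> B" "R > 0" "\<And>x. cmod (g x) \<le> R"
  shows "cmod ((N ^^ n) g x - ell g * E n x) \<le> 8 * R * \<eta> ^ n * cmod (E n x)"
proof -
  obtain L where L: "\<forall>n x. cmod ((N ^^ n) g x - L * E n x) \<le> 8 * R * \<eta> ^ n * cmod (E n x)"
    using ratio_convergence[OF assms] ..
  have *: "(\<lambda>n. (N ^^ n) g undefined / E n undefined) \<longlonglongrightarrow> L" by (rule ell_unique[OF L[rule_format]])
  have "ell g = L" unfolding ell_def by (rule limI[OF *])
  then show ?thesis using L[rule_format, of n x] by (simp only:)
qed

text \<open>The case \<open>n = 0\<close> of \<open>ell_bound\<close>, where \<open>E 0 = 1\<close>,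
  puts \<open>ell g\<close> within \<open>8 R\<close> of a value of \<open>g\<close>.\<close>

lemma ell_norm: assumes "g \<in> B" "R > 0" "\<And>x. cmod (g x) \<le> R" shows "cmod (ell g) \<le> 9 * R"
proof -
  have "cmod (g undefined - ell g) \<le> 8 * R" using ell_bound[OF assms, of 0 undefined] by simp
  then show ?thesis using assms(3)[of undefined] norm_triangle_sub[of "ell g" "g undefined"]
    by (simp add: norm_minus_commute)
qed

lemma ell_lin:
  assumes "f \<in> B" "g \<in> B" shows "ell (\<lambda>x. c * f x + d * g x) = c * ell f + d * ell g"
proof (rule LIMSEQ_unique[OF ell_tendsto[OF B_lin[OF assms]]])
  have "(\<lambda>n. c * ((N ^^ n) f undefined / E n undefined) + d * ((N ^^ n) g undefined / E n undefined))
    \<longlonglongrightarrow> c * ell f + d * ell g"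
    by (intro tendsto_intros ell_tendsto assms)
  then show "(\<lambda>n. (N ^^ n) (\<lambda>x. c * f x + d * g x) undefined / E n undefined) \<longlonglongrightarrow> c * ell f + d * ell g"
    by (simp add: funpow_N_lin[OF assms] add_divide_distrib)
qed

lemma ell_1: "ell (\<lambda>_. 1) = 1"
  by (rule LIMSEQ_unique[OF ell_tendsto[OF B_const]]) (simp add: E_nonzero)

section \<open>The leading eigenvalue and the growth of the iterates\<close>

definition lam :: complex where "lam = ell (N (\<lambda>_. 1))"

text \<open>The ratio for \<open>N g\<close> is the product of \<open>E (Suc n) / E n\<close>, which
  tends to \<open>lam\<close>, and the ratio for \<open>g\<close> at index
  \<open>Suc n\<close>.\<close>

lemma ell_N: assumes g: "g \<in> B" shows "ell (N g) = lam * ell g"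
proof (rule LIMSEQ_unique[OF ell_tendsto[OF N_B[OF g]]])
  have "(\<lambda>n. (N ^^ n) (N (\<lambda>_. 1)) undefined / E n undefined * ((N ^^ Suc n) g undefined / E (Suc n) undefined))
    \<longlonglongrightarrow> lam * ell g"
    unfolding lam_def
    by (intro tendsto_intros ell_tendsto N_B B_const LIMSEQ_Suc[OF ell_tendsto[OF g]])
  moreover have "(N ^^ n) (N (\<lambda>_. 1)) undefined / E n undefined * ((N ^^ Suc n) g undefined / E (Suc n) undefined)
     = (N ^^ n) (N g) undefined / E n undefined" for n
    using E_nonzero[of "Suc n" undefined] by (simp add: funpow_swap1)
  ultimately show "(\<lambda>n. (N ^^ n) (N g) undefined / E n undefined) \<longlonglongrightarrow> lam * ell g" by simp
qed

lemma E_step: "cmod (E (Suc n) x - lam * E n x) \<le> 8 * (b * mass) * \<eta> ^ n * cmod (E n x)"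
proof -
  have "cmod ((N ^^ n) (N (\<lambda>_. 1)) x - ell (N (\<lambda>_. 1)) * E n x) \<le> 8 * (b * mass) * \<eta> ^ n * cmod (E n x)"
    using b_pos mass_pos N_bound[of "\<lambda>_. 1" 1] by (intro ell_bound N_B B_const) auto
  then show ?thesis by (simp add: lam_def funpow_swap1)
qed

text \<open>Uniform acuteness prevents cancellation in the integral of \<open>E (Suc n)\<close>,
  which has modulus at least \<open>mass * \<delta>\<close> times that of any value; the second
  bound of \<open>N_acute\<close> passes this on to the next iterate. The index \<open>Suc n\<close>
  ensures that the function is an image under \<open>N\<close>.\<close>

lemma E_lower: "sqrt (A - D) * mass * \<delta> * cmod (E (Suc n) x) \<le> cmod (E (Suc (Suc n)) x)"
proof -
  let ?f = "E (Suc n)"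
  let ?I = "LINT s|M. ?f s"
  have low: "\<delta> * (cmod (?f x))\<^sup>2 \<le> Re (?f s * cnj (?f x))" for s
    using N_acute(1)[OF E_B[of n] E_acute[of n], of x s x] by simp
  have "mass * (\<delta> * (cmod (?f x))\<^sup>2) = (LINT s|M. \<delta> * (cmod (?f x))\<^sup>2)" by simp
  also have "\<dots> \<le> (LINT s|M. Re (?f s * cnj (?f x)))"
    using B_integrable[OF E_B[of "Suc n"]] low by (intro integral_mono) auto
  also have "\<dots> = Re (LINT s|M. ?f s * cnj (?f x))"
    using B_integrable[OF E_B[of "Suc n"]] by (intro integral_Re) auto
  also have "\<dots> = Re (?I * cnj (?f x))" by (simp only: integral_mult_left_zero)
  also have "\<dots> \<le> cmod ?I * cmod (?f x)"
    using order_trans[OF abs_ge_self abs_Re_le_cmod[of "?I * cnj (?f x)"]]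
    by (simp only: norm_mult complex_mod_cnj)
  finally have *: "mass * (\<delta> * (cmod (?f x))\<^sup>2) \<le> cmod ?I * cmod (?f x)" .
  have 1: "mass * \<delta> * cmod (?f x) \<le> cmod ?I"
  proof -
    have "mass * (\<delta> * (cmod (?f x))\<^sup>2) = (mass * \<delta> * cmod (?f x)) * cmod (?f x)"
      by (simp only: power2_eq_square mult_ac)
    with * have "(mass * \<delta> * cmod (?f x)) * cmod (?f x) \<le> cmod ?I * cmod (?f x)" by (simp only:)
    then show ?thesis using E_nonzero[of "Suc n" x] by (subst (asm) mult_le_cancel_right_pos) (simp_all only: zero_less_norm_iff not_False_eq_True)
  qed
  have "(A - D) * (cmod ?I)\<^sup>2 \<le> (cmod (N ?f x))\<^sup>2"
    using N_acute(2)[OF E_B[of "Suc n"] E_acute[of "Suc n"], of x x] by (simp only: Re_mult_cnj_self)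
  then have "(sqrt (A - D) * cmod ?I)\<^sup>2 \<le> (cmod (N ?f x))\<^sup>2"
    using D_less_A by (simp only: power_mult_distrib real_sqrt_pow2 diff_ge_0_iff_ge less_imp_le)
  then have "sqrt (A - D) * cmod ?I \<le> cmod (N ?f x)"
    by (rule power2_le_imp_le) (rule norm_ge_zero)
  moreover have "sqrt (A - D) * (mass * \<delta> * cmod (?f x)) \<le> sqrt (A - D) * cmod ?I"
    by (rule mult_left_mono[OF 1]) (use D_less_A in simp)
  moreover have "E (Suc (Suc n)) x = N ?f x" by simp
  ultimately show ?thesis by (simp only: mult.assoc)
qed

text \<open>With \<open>lam = 0\<close>, \<open>E_step\<close> would force the quotients of
  successive iterates to tend to 0, against the fixed bound in \<open>E_lower\<close>.\<close>

lemma lam_nonzero: "lam \<noteq> 0"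
proof
  assume "lam = 0"
  have "norm (sqrt (A - D) * mass * \<delta>) \<le> 8 * (b * mass) * \<eta> * \<eta> ^ n" for n
  proof -
    have "sqrt (A - D) * mass * \<delta> * cmod (E (Suc n) undefined) \<le> 8 * (b * mass) * \<eta> ^ Suc n * cmod (E (Suc n) undefined)"
      using order_trans[OF E_lower[of n undefined]] E_step[of "Suc n" undefined] \<open>lam = 0\<close> by simp
    then show ?thesis using E_nonzero[of "Suc n" undefined] mass_pos delta D_less_A by (simp add: mult.assoc)
  qed
  then have "sqrt (A - D) * mass * \<delta> = 0" using eta by (intro eq_0_if_geometric_bound) auto
  then show False using mass_pos delta D_less_A by simp
qed

definition G :: real where "G = exp (8 * (b * mass) / cmod lam / (1 - \<eta>))"
definition \<rho> :: real where "\<rho> = \<eta> * cmod lam"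

lemma rho: "0 < \<rho>" "\<rho> < cmod lam"
  using eta lam_nonzero by (auto simp: \<rho>_def)

text \<open>
  Iterating \<open>E_step\<close> gives the product of the \<open>|\<lambda>| (1 + c \<eta>\<^sup>j)\<close>, which is at most
  \<open>|\<lambda>|\<^sup>n exp (c / (1 - \<eta>))\<close>.
\<close>

lemma E_growth: "cmod (E n x) \<le> G * cmod lam ^ n"
proof -
  let ?C = "8 * (b * mass) / cmod lam"
  have C: "?C \<ge> 0" using b_pos by simp
  have "cmod (E n x) \<le> exp (?C * (\<Sum>j<n. \<eta> ^ j)) * cmod lam ^ n"
  proof (induction n)
    case (Suc n)
    have "cmod (E (Suc n) x) \<le> cmod (lam * E n x) + cmod (E (Suc n) x - lam * E n x)"
      by (rule norm_triangle_sub)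
    also have "\<dots> \<le> cmod lam * cmod (E n x) + 8 * (b * mass) * \<eta> ^ n * cmod (E n x)"
      using E_step[of n x] by (simp only: norm_mult add_left_mono)
    also have "\<dots> = cmod lam * (1 + ?C * \<eta> ^ n) * cmod (E n x)"
      using lam_nonzero by (simp add: field_simps)
    also have "\<dots> \<le> cmod lam * exp (?C * \<eta> ^ n) * (exp (?C * (\<Sum>j<n. \<eta> ^ j)) * cmod lam ^ n)"
    proof (intro mult_mono Suc.IH mult_left_mono)
      show "1 + ?C * \<eta> ^ n \<le> exp (?C * \<eta> ^ n)" by (rule exp_ge_add_one_self)
      show "0 \<le> 1 + ?C * \<eta> ^ n" using C eta by (intro add_nonneg_nonneg mult_nonneg_nonneg) auto
    qed auto
    also have "\<dots> = exp (?C * (\<Sum>j<Suc n. \<eta> ^ j)) * cmod lam ^ Suc n"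
    proof -
      have "exp (?C * (\<Sum>j<Suc n. \<eta> ^ j)) = exp (?C * \<eta> ^ n) * exp (?C * (\<Sum>j<n. \<eta> ^ j))"
        unfolding sum.lessThan_Suc distrib_left exp_add by (rule mult.commute)
      then show ?thesis by (simp only: power_Suc mult_ac)
    qed
    finally show ?case .
  qed simp
  also have "\<dots> \<le> G * cmod lam ^ n"
  proof -
    have "(\<Sum>j<n. \<eta> ^ j) = (1 - \<eta> ^ n) / (1 - \<eta>)" using eta by (subst sum_gp_strict) simp
    also have "\<dots> \<le> 1 / (1 - \<eta>)" using eta by (intro divide_right_mono) auto
    finally have "?C * (\<Sum>j<n. \<eta> ^ j) \<le> ?C * (1 / (1 - \<eta>))" using C by (intro mult_left_mono)
    then have "?C * (\<Sum>j<n. \<eta> ^ j) \<le> ?C / (1 - \<eta>)" by (simp only: times_divide_eq_right mult_1_right)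
    then have "exp (?C * (\<Sum>j<n. \<eta> ^ j)) \<le> G" unfolding G_def by (subst exp_le_cancel_iff)
    then show ?thesis by (rule mult_right_mono) (rule zero_le_power[OF norm_ge_zero])
  qed
  finally show ?thesis .
qed

lemma kernel_decay:
  assumes "g \<in> B" "R > 0" "\<And>x. cmod (g x) \<le> R" "ell g = 0"
  shows "cmod ((N ^^ n) g x) \<le> 8 * R * G * \<rho> ^ n"
proof -
  have "cmod ((N ^^ n) g x) \<le> 8 * R * \<eta> ^ n * cmod (E n x)" using ell_bound[OF assms(1-3), of n x] assms(4) by simp
  also have "\<dots> \<le> 8 * R * \<eta> ^ n * (G * cmod lam ^ n)" using assms eta E_growth by (intro mult_left_mono) auto
  also have "\<dots> = 8 * R * G * \<rho> ^ n" unfolding \<rho>_def power_mult_distrib by (simp only: mult_ac)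
  finally show ?thesis .
qed

lemma ell_sum: "(\<And>i. i < K \<Longrightarrow> f i \<in> B) \<Longrightarrow> (\<lambda>x. \<Sum>i<(K::nat). f i x) \<in> B \<and> ell (\<lambda>x. \<Sum>i<K. f i x) = (\<Sum>i<K. ell (f i))"
proof (induction K)
  case 0
  have "ell (\<lambda>x. 0) = 0" using ell_lin[OF B_const[of 1] B_const[of 1], of 0 0] by simp
  then show ?case by (simp add: B_const)
next
  case (Suc K)
  then show ?case
    using B_lin[of "\<lambda>x. \<Sum>i<K. f i x" "f K" 1 1] ell_lin[of "\<lambda>x. \<Sum>i<K. f i x" "f K" 1 1] by simp
qed

lemma ell_funpow: "g \<in> B \<Longrightarrow> ell ((N ^^ n) g) = lam ^ n * ell g"
  by (induction n) (auto simp: ell_N funpow_N_B)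

section \<open>Eigenfunctions and resolvent on bounded functions\<close>

lemma resolvent_on_kernel:
  assumes g: "g \<in> B" and R: "R > 0" "\<And>x. cmod (g x) \<le> R" and ker: "ell g = 0" and z: "\<rho> < cmod z"
  shows "\<exists>w\<in>B. ell w = 0 \<and> (\<forall>x. z * w x - N w x = g x) \<and> (\<forall>x. cmod (w x) \<le> 8 * R * G / (cmod z - \<rho>))"
proof -
  define a where "a n x = (N ^^ n) g x / z ^ Suc n" for n x
  define q where "q = \<rho> / cmod z"
  define T where "T = 8 * R * G / (cmod z - \<rho>)"
  define w where "w x = (\<Sum>n. a n x)" for x
  define S where "S K x = (\<Sum>n<K. a n x)" for K x
  have z0: "z \<noteq> 0" using z rho by auto
  have q: "0 < q" "q < 1" using z rho z0 by (auto simp: q_def)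
  have T: "T > 0" using R z by (auto simp: T_def G_def)
  \<comment> \<open>This form of the majorant makes its tail from \<open>K\<close> on equal to
    \<open>T * q ^ K\<close>.\<close>
  have a_le: "cmod (a n x) \<le> T * (1 - q) * q ^ n" for n x
  proof -
    have "cmod (a n x) \<le> 8 * R * G * \<rho> ^ n / cmod z ^ Suc n"
      unfolding a_def norm_divide norm_power using kernel_decay[OF g R ker] by (intro divide_right_mono) auto
    also have "\<dots> = 8 * R * G / cmod z * q ^ n" by (simp add: q_def power_divide)
    also have "8 * R * G / cmod z = T * (1 - q)" using z z0 by (simp add: T_def q_def field_simps)
    finally show ?thesis .
  qed
  have sm: "summable (\<lambda>n. T * (1 - q) * q ^ (n + K))" for K
    using q by (simp add: power_add summable_mult2 summable_geometric flip: mult.assoc)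
  have tail: "(\<Sum>n. T * (1 - q) * q ^ (n + K)) = T * q ^ K" for K
  proof -
    have "(\<lambda>n. q ^ n) sums (1 / (1 - q))" using q by (intro geometric_sums) auto
    from sums_mult[OF this, of "T * (1 - q) * q ^ K"] have "(\<lambda>n. T * (1 - q) * q ^ (n + K)) sums (T * q ^ K)"
      using q by (simp add: power_add mult_ac)
    then show ?thesis by (rule sums_unique[symmetric])
  qed
  have summ: "summable (\<lambda>n. a n x)" for x
  proof (rule summable_comparison_test'[of "\<lambda>n. T * (1 - q) * q ^ n" 0])
    show "summable (\<lambda>n. T * (1 - q) * q ^ n)" using sm[of 0] by (simp only: add_0_right)
  qed (rule a_le)
  have rest: "cmod (w x - S K x) \<le> T * q ^ K" for x K
  proof -
    have "w x - S K x = (\<Sum>n. a (n + K) x)"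
      unfolding w_def S_def using suminf_minus_initial_segment[OF summ[of x], of K] by simp
    also have "cmod \<dots> \<le> (\<Sum>n. T * (1 - q) * q ^ (n + K))"
      by (intro norm_suminf_le a_le sm)
    finally show ?thesis by (simp add: tail)
  qed
  have aB: "a n \<in> B" for n
  proof -
    have "a n = (\<lambda>x. (1 / z ^ Suc n) * (N ^^ n) g x + 0 * (N ^^ n) g x)" by (auto simp: a_def)
    then show ?thesis using B_lin[OF funpow_N_B[OF g, of n] funpow_N_B[OF g, of n], of "1 / z ^ Suc n" 0] by simp
  qed
  have ell_a: "ell (a n) = 0" for n
  proof -
    have "a n = (\<lambda>x. (1 / z ^ Suc n) * (N ^^ n) g x + 0 * (N ^^ n) g x)" by (auto simp: a_def)
    then show ?thesis using ell_lin[OF funpow_N_B[OF g, of n] funpow_N_B[OF g, of n], of "1 / z ^ Suc n" 0]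
      by (simp add: ell_funpow g ker)
  qed
  have SB: "S K \<in> B" and ell_S: "ell (S K) = 0" for K
    using ell_sum[of K a] aB ell_a unfolding S_def[abs_def] by auto
  have w_bound: "cmod (w x) \<le> T" for x using rest[of x 0] by (simp add: S_def)
  have wB: "w \<in> B"
  proof (rule BI[OF _ w_bound])
    have [measurable]: "a n \<in> borel_measurable M" for n using aB by (rule B_measurable)
    show "w \<in> borel_measurable M" unfolding w_def[abs_def] by measurable
  qed
  have dB: "(\<lambda>x. w x - S K x) \<in> B" for K using B_lin[OF wB SB[of K], of 1 "- 1"] by simp
  \<comment> \<open>Partial sums solve the equation up to the iterate of order \<open>K\<close>. The
    limit is then taken by estimating errors, without exchanging \<open>N\<close> and the infinite
    sum.\<close>
  have tel: "z * S K x - N (S K) x = g x - (N ^^ K) g x / z ^ K" for K x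
  proof (induction K arbitrary: x)
    case 0
    have "S 0 = (\<lambda>_. 0)" by (auto simp: S_def)
    then show ?case by (simp add: N_def)
  next
    case (Suc K)
    have "S (Suc K) = (\<lambda>x. 1 * S K x + (1 / z ^ Suc K) * (N ^^ K) g x)"
      by (auto simp: S_def a_def)
    then have "N (S (Suc K)) = (\<lambda>x. 1 * N (S K) x + (1 / z ^ Suc K) * N ((N ^^ K) g) x)"
      using N_lin[OF SB[of K] funpow_N_B[OF g, of K], of 1 "1 / z ^ Suc K"] by (simp only:)
    moreover have "S (Suc K) x = S K x + a K x" by (simp add: S_def)
    ultimately show ?case using Suc[of x] z0 by (simp add: a_def field_simps)
  qed
  have "z * w x - N w x - g x = 0" for x
  proof (rule eq_0_if_geometric_bound)
    fix K
    have Nd: "N (\<lambda>x. w x - S K x) = (\<lambda>x. N w x - N (S K) x)" using N_lin[OF wB SB[of K], of 1 "- 1"] by simp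
    have "z * w x - N w x - g x = z * (w x - S K x) - N (\<lambda>x. w x - S K x) x - (N ^^ K) g x / z ^ K"
      using tel[of K x] by (simp add: Nd algebra_simps)
    also have "cmod \<dots> \<le> cmod (z * (w x - S K x)) + cmod (N (\<lambda>x. w x - S K x) x) + cmod ((N ^^ K) g x / z ^ K)"
      by (intro order_trans[OF norm_triangle_ineq4] add_mono norm_triangle_ineq4 order_refl)
    also have "\<dots> \<le> cmod z * (T * q ^ K) + b * mass * (T * q ^ K) + 8 * R * G * q ^ K"
    proof (intro add_mono)
      show "cmod (z * (w x - S K x)) \<le> cmod z * (T * q ^ K)" using rest by (simp add: norm_mult mult_left_mono)
      show "cmod (N (\<lambda>x. w x - S K x) x) \<le> b * mass * (T * q ^ K)" using rest dB by (intro N_bound) auto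
      have "cmod ((N ^^ K) g x / z ^ K) \<le> 8 * R * G * \<rho> ^ K / cmod z ^ K"
        unfolding norm_divide norm_power using kernel_decay[OF g R ker] by (intro divide_right_mono) auto
      then show "cmod ((N ^^ K) g x / z ^ K) \<le> 8 * R * G * q ^ K" by (simp add: q_def power_divide)
    qed
    also have "\<dots> = (cmod z * T + b * mass * T + 8 * R * G) * q ^ K" by (simp add: algebra_simps)
    finally show "cmod (z * w x - N w x - g x) \<le> (cmod z * T + b * mass * T + 8 * R * G) * q ^ K" .
  qed (use q in auto)
  moreover have "ell w = 0"
  proof (rule eq_0_if_geometric_bound)
    fix K
    have "ell (\<lambda>x. w x - S K x) = ell w" using ell_lin[OF wB SB[of K], of 1 "- 1"] by (simp add: ell_S)
    moreover have "cmod (ell (\<lambda>x. w x - S K x)) \<le> 9 * (T * q ^ K)"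
      using dB T q rest by (intro ell_norm) auto
    ultimately show "cmod (ell w) \<le> 9 * T * q ^ K" by (simp add: mult.assoc)
  qed (use q in auto)
  ultimately show ?thesis using wB w_bound by (auto simp: T_def)
qed

text \<open>The constant 1 is corrected by a \<open>w\<close> in the kernel of \<open>ell\<close>.
  By definition of \<open>lam\<close> this kernel contains \<open>N 1 - lam\<close>, so
  \<open>(lam - N) w = N 1 - lam\<close> is solvable, which says that \<open>1 + w\<close> is an
  eigenfunction.\<close>

lemma eigenfunction: "\<exists>v\<in>B. ell v = 1 \<and> (\<forall>x. N v x = lam * v x)"
proof -
  define g where "g x = 1 * N (\<lambda>_. 1) x + (- lam) * 1" for x
  have gB: "g \<in> B" unfolding g_def[abs_def] by (intro B_lin N_B B_const)
  have "ell g = 0" unfolding g_def[abs_def] using ell_lin[OF N_B[OF B_const[of 1]] B_const[of 1], of 1 "- lam"]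
    by (simp add: ell_N B_const ell_1)
  moreover obtain R where "R > 0" "\<And>x. cmod (g x) \<le> R" using B_bound[OF gB] by blast
  ultimately obtain w where w: "w \<in> B" "ell w = 0" "\<And>x. lam * w x - N w x = g x"
    using resolvent_on_kernel[OF gB _ _ _ rho(2)] by blast
  have "N (\<lambda>x. 1 * 1 + 1 * w x) = (\<lambda>x. 1 * N (\<lambda>_. 1) x + 1 * N w x)"
    by (rule N_lin[OF B_const w(1)])
  then have Nw: "N (\<lambda>x. 1 + w x) = (\<lambda>x. N (\<lambda>_. 1) x + N w x)" by (simp only: mult_1)
  have "N (\<lambda>x. 1 + w x) x = lam * (1 + w x)" for x
  proof -
    have "N w x = lam * w x - g x" using w(3)[of x, symmetric] by simp
    then show ?thesis unfolding Nw g_def by (simp add: algebra_simps)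
  qed
  moreover have "ell (\<lambda>x. 1 * 1 + 1 * w x) = 1 * ell (\<lambda>_. 1) + 1 * ell w"
    by (rule ell_lin[OF B_const w(1)])
  then have "ell (\<lambda>x. 1 + w x) = 1" by (simp only: mult_1 ell_1 w(2) add_0_right)
  moreover have "(\<lambda>x. 1 * 1 + 1 * w x) \<in> B" by (rule B_lin[OF B_const w(1)])
  then have "(\<lambda>x. 1 + w x) \<in> B" by (simp only: mult_1)
  ultimately show ?thesis by blast
qed

definition v :: "'a \<Rightarrow> complex" where "v = (SOME v. v \<in> B \<and> ell v = 1 \<and> (\<forall>x. N v x = lam * v x))"

lemma v: "v \<in> B" "ell v = 1" "N v x = lam * v x"
proof -
  have "v \<in> B \<and> ell v = 1 \<and> (\<forall>x. N v x = lam * v x)"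
    using someI_ex[OF eigenfunction[unfolded Bex_def]] unfolding v_def[symmetric] .
  then show "v \<in> B" "ell v = 1" "N v x = lam * v x" by auto
qed

text \<open>Applying \<open>ell\<close> gives \<open>(z - lam) * ell w = 0\<close>. After
  subtraction of a multiple of \<open>v\<close> only the kernel of \<open>ell\<close> remains, where
  iterates growing like \<open>|z|^n\<close> contradict the decay like
  \<open>\<rho>^n\<close>.\<close>

lemma eigenfunction_unique:
  assumes w: "w \<in> B" and z: "\<rho> < cmod z" and eq: "\<And>x. N w x = z * w x"
  shows "w x = (if z = lam then ell w * v x else 0)"
proof -
  have null: "u x = 0" if u: "u \<in> B" "ell u = 0" "\<And>x. N u x = z * u x" for u x
  proof -
    obtain R where R: "R > 0" "\<And>x. cmod (u x) \<le> R" using B_bound[OF u(1)] by blast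
    have pow: "(N ^^ n) u = (\<lambda>x. z ^ n * u x)" for n
    proof (induction n)
      case (Suc n)
      then show ?case using N_scale[OF u(1), of "z ^ n"] u(3) by (simp add: mult_ac)
    qed simp
    have zp: "0 < cmod z" using z rho by linarith
    have "u x = 0"
    proof (rule eq_0_if_geometric_bound)
      fix n
      have "cmod z ^ n * cmod (u x) \<le> 8 * R * G * \<rho> ^ n"
        using kernel_decay[OF u(1) R u(2), of n x] unfolding pow by (simp add: norm_mult norm_power)
      then have "cmod (u x) \<le> 8 * R * G * \<rho> ^ n / cmod z ^ n"
        using zp by (subst pos_le_divide_eq) (simp_all add: mult.commute)
      then show "cmod (u x) \<le> 8 * R * G * (\<rho> / cmod z) ^ n" by (simp add: power_divide)
    qed (use z rho in \<open>auto simp: divide_less_eq\<close>)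
    then show ?thesis .
  qed
  have "z * ell w = lam * ell w"
  proof -
    have "N w = (\<lambda>x. z * w x + 0 * w x)" using eq by auto
    then have "ell (N w) = z * ell w" using ell_lin[OF w w, of z 0] by simp
    from this ell_N[OF w] show ?thesis by (rule trans[OF sym])
  qed
  show ?thesis
  proof (cases "z = lam")
    case False
    then show ?thesis using null[OF w _ eq] \<open>z * ell w = lam * ell w\<close> by simp
  next
    case True
    define u where "u x = 1 * w x + (- ell w) * v x" for x
    have "u x = 0"
    proof (rule null)
      show "u \<in> B" unfolding u_def[abs_def] by (intro B_lin w v)
      show "ell u = 0" unfolding u_def[abs_def] using ell_lin[OF w v(1), of 1 "- ell w"] by (simp add: v(2))
      show "N u x = z * u x" for x
        unfolding u_def[abs_def] N_lin[OF w v(1)] using True by (simp add: eq v(3) algebra_simps)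
    qed
    then show ?thesis using True by (simp add: u_def)
  qed
qed

text \<open>The datum splits into a multiple of \<open>v\<close>, on which \<open>z - N\<close> is
  the scalar \<open>z - lam\<close>, and a part in the kernel of \<open>ell\<close>. That
  \<open>K\<close> is common to all data yields a bounded inverse.\<close>

lemma resolvent:
  assumes z: "\<rho> < cmod z" "z \<noteq> lam"
  shows "\<exists>K. \<forall>g\<in>B. \<forall>R>0. (\<forall>x. cmod (g x) \<le> R) \<longrightarrow>
    (\<exists>w\<in>B. (\<forall>x. z * w x - N w x = g x) \<and> (\<forall>x. cmod (w x) \<le> K * R))"
proof -
  obtain V where V: "V > 0" "\<And>x. cmod (v x) \<le> V" using B_bound[OF v(1)] by blast
  define K where "K = 8 * (1 + 9 * V) * G / (cmod z - \<rho>) + 9 * V / cmod (z - lam)"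
  have "\<exists>w\<in>B. (\<forall>x. z * w x - N w x = g x) \<and> (\<forall>x. cmod (w x) \<le> K * R)"
    if g: "g \<in> B" and R: "R > 0" "\<And>x. cmod (g x) \<le> R" for g R
  proof -
    define h where "h x = 1 * g x + (- ell g) * v x" for x
    have hB: "h \<in> B" unfolding h_def[abs_def] by (intro B_lin g v)
    have ell_h: "ell h = 0" unfolding h_def[abs_def] using ell_lin[OF g v(1), of 1 "- ell g"] by (simp add: v(2))
    have eg: "cmod (ell g) \<le> 9 * R" by (rule ell_norm[OF g R])
    have h_le: "cmod (h x) \<le> (1 + 9 * V) * R" for x
    proof -
      have "cmod (h x) \<le> cmod (g x) + cmod (ell g) * cmod (v x)"
        unfolding h_def using norm_triangle_ineq4[of "g x" "ell g * v x"] by (simp add: norm_mult)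
      also have "\<dots> \<le> R + (9 * R) * V" using R V eg by (intro add_mono mult_mono) auto
      finally show ?thesis by (simp add: algebra_simps)
    qed
    obtain w where w: "w \<in> B" "\<And>x. z * w x - N w x = h x"
      "\<And>x. cmod (w x) \<le> 8 * ((1 + 9 * V) * R) * G / (cmod z - \<rho>)"
    proof -
      have "0 < (1 + 9 * V) * R" using R V by (simp add: add_pos_pos)
      from resolvent_on_kernel[OF hB this h_le ell_h z(1)] show ?thesis using that by blast
    qed
    define e where "e = ell g / (z - lam)"
    let ?w = "\<lambda>x. 1 * w x + e * v x"
    have e: "e * (z - lam) = ell g" using z by (simp add: e_def)
    have "z * ?w x - N ?w x = g x" for x
    proof -
      have "z * ?w x - N ?w x = h x + (e * (z - lam)) * v x"
        unfolding N_lin[OF w(1) v(1)] v(3) w(2)[symmetric] by (simp add: algebra_simps)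
      then show ?thesis unfolding e by (simp add: h_def)
    qed
    moreover have "cmod (?w x) \<le> K * R" for x
    proof -
      have "cmod (?w x) \<le> cmod (w x) + cmod e * cmod (v x)"
        using norm_triangle_ineq[of "w x" "e * v x"] by (simp add: norm_mult)
      also have "\<dots> \<le> 8 * ((1 + 9 * V) * R) * G / (cmod z - \<rho>) + 9 * R / cmod (z - lam) * V"
        using w(3)[of x] V eg R unfolding e_def norm_divide by (intro add_mono mult_mono divide_right_mono) auto
      also have "\<dots> = K * R" by (simp add: K_def algebra_simps)
      finally show ?thesis .
    qed
    moreover have "?w \<in> B" by (rule B_lin[OF w(1) v(1)])
    ultimately show ?thesis by (intro bexI[of _ ?w] conjI allI)
  qed
  then show ?thesis by blast
qed

end

section \<open>The spaces \<open>L\<^sup>p\<close>\<close>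

lemma Lp_measurable: "f \<in> Lp p M \<Longrightarrow> f \<in> borel_measurable M"
  by (simp add: Lp_def)

lemma Lp_norm_nonneg: "0 \<le> Lp_norm p M f"
  by (simp add: Lp_norm_def)

lemma Linf_AE_le_norm: assumes "f \<in> Lp \<infinity> M" shows "AE x in M. norm (f x) \<le> Lp_norm \<infinity> M f"
proof -
  have "esssup M (\<lambda>x. ennreal (norm (f x))) < \<infinity>" using assms by (simp add: Lp_def)
  then have "esssup M (\<lambda>x. ennreal (norm (f x))) = ennreal (Lp_norm \<infinity> M f)"
    by (simp add: Lp_norm_def)
  then have "AE x in M. ennreal (norm (f x)) \<le> ennreal (Lp_norm \<infinity> M f)"
    using esssup_AE[of "\<lambda>x. ennreal (norm (f x))" M] by simp
  then show ?thesis by eventually_elim (simp add: Lp_norm_nonneg)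
qed

lemma LinfI:
  assumes "f \<in> borel_measurable M" "AE x in M. norm (f x) \<le> C" "0 \<le> C"
  shows "f \<in> Lp \<infinity> M" "Lp_norm \<infinity> M f \<le> C"
proof -
  have "AE x in M. ennreal (norm (f x)) \<le> ennreal C"
    using assms(2) by eventually_elim (simp add: assms(3))
  then have le: "esssup M (\<lambda>x. ennreal (norm (f x))) \<le> ennreal C"
    using assms(1) by (intro esssup_I) auto
  then show "f \<in> Lp \<infinity> M" using assms(1) by (auto simp: Lp_def intro: le_less_trans)
  have "enn2real (esssup M (\<lambda>x. ennreal (norm (f x)))) \<le> enn2real (ennreal C)"
    using le by (intro enn2real_mono) auto
  then show "Lp_norm \<infinity> M f \<le> C" using assms(3) by (simp add: Lp_norm_def)
qed

lemma finite_exponent: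
  fixes p :: ennreal
  assumes "1 \<le> p" "p \<noteq> \<infinity>"
  shows "1 \<le> enn2real p"
  using enn2real_mono[OF assms(1)] assms(2) by (simp add: top.not_eq_extremum)

text \<open>The two functions may have different target spaces, so the real function
  \<open>h\<close> can dominate complex ones.\<close>

lemma Lp_dominated:
  assumes p: "1 \<le> p" and f: "f \<in> Lp p M" and g: "g \<in> borel_measurable M"
    and le: "AE x in M. norm (g x) \<le> C * norm (f x)" and C: "0 \<le> C"
  shows "g \<in> Lp p M" "Lp_norm p M g \<le> C * Lp_norm p M f"
proof -
  have "g \<in> Lp p M \<and> Lp_norm p M g \<le> C * Lp_norm p M f"
  proof (cases "p = \<infinity>")
    case True
    have "AE x in M. norm (g x) \<le> C * Lp_norm \<infinity> M f"
      using le Linf_AE_le_norm[OF f[unfolded True]]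
      by eventually_elim (use C in \<open>auto intro: order_trans mult_left_mono\<close>)
    then show ?thesis using LinfI[OF g] C True by (simp add: Lp_norm_nonneg)
  next
    case False
    define r where "r = enn2real p"
    have r: "1 \<le> r" using finite_exponent[OF p False] by (simp add: r_def)
    have int: "integrable M (\<lambda>x. norm (f x) powr r)" using f False by (simp add: Lp_def r_def)
    have le': "AE x in M. norm (g x) powr r \<le> C powr r * norm (f x) powr r"
      using le
    proof eventually_elim
      case (elim x)
      then have "norm (g x) powr r \<le> (C * norm (f x)) powr r" using r by (intro powr_mono2) auto
      then show ?case using C by (simp add: powr_mult)
    qed
    have int': "integrable M (\<lambda>x. norm (g x) powr r)"
    proof (rule Bochner_Integration.integrable_bound)
      show "integrable M (\<lambda>x. C powr r * norm (f x) powr r)" using int by simp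
      show "(\<lambda>x. norm (g x) powr r) \<in> borel_measurable M" using g by measurable
      show "AE x in M. norm (norm (g x) powr r) \<le> norm (C powr r * norm (f x) powr r)"
        using le' by eventually_elim simp
    qed
    have "(LINT x|M. norm (g x) powr r) \<le> (LINT x|M. C powr r * norm (f x) powr r)"
      using int int' le' by (intro integral_mono_AE) auto
    then have "(LINT x|M. norm (g x) powr r) powr (1 / r)
        \<le> (C powr r * (LINT x|M. norm (f x) powr r)) powr (1 / r)"
      using r by (intro powr_mono2) auto
    also have "\<dots> = C * (LINT x|M. norm (f x) powr r) powr (1 / r)"
      using r C by (simp add: powr_mult powr_powr)
    finally show ?thesis using g int' False by (simp add: Lp_def Lp_norm_def r_def)
  qed
  then show "g \<in> Lp p M" "Lp_norm p M g \<le> C * Lp_norm p M f" by auto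
qed

text \<open>A triangle inequality up to a constant serves to bound operators. One factor 2 comes
  from \<open>|f + g| \<le> 2 max |f| |g|\<close>, the other from the root of
  \<open>I + J\<close>.\<close>

lemma Lp_add:
  fixes f g :: "'a \<Rightarrow> 'b::{real_normed_vector, second_countable_topology}"
  assumes p: "1 \<le> p" and f: "f \<in> Lp p M" and g: "g \<in> Lp p M"
  shows "(\<lambda>x. f x + g x) \<in> Lp p M"
    "Lp_norm p M (\<lambda>x. f x + g x) \<le> 4 * (Lp_norm p M f + Lp_norm p M g)"
proof -
  have [measurable]: "f \<in> borel_measurable M" "g \<in> borel_measurable M"
    using f g by (auto dest: Lp_measurable)
  have "(\<lambda>x. f x + g x) \<in> Lp p M \<and>
    Lp_norm p M (\<lambda>x. f x + g x) \<le> 4 * (Lp_norm p M f + Lp_norm p M g)"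
  proof (cases "p = \<infinity>")
    case True
    have "AE x in M. norm (f x + g x) \<le> Lp_norm \<infinity> M f + Lp_norm \<infinity> M g"
      using Linf_AE_le_norm[OF f[unfolded True]] Linf_AE_le_norm[OF g[unfolded True]]
      by eventually_elim (rule norm_triangle_mono)
    then have "(\<lambda>x. f x + g x) \<in> Lp \<infinity> M"
      "Lp_norm \<infinity> M (\<lambda>x. f x + g x) \<le> Lp_norm \<infinity> M f + Lp_norm \<infinity> M g"
      by (intro LinfI add_nonneg_nonneg Lp_norm_nonneg; measurable)+
    then show ?thesis using True Lp_norm_nonneg[of \<infinity> M f] Lp_norm_nonneg[of \<infinity> M g] by simp
  next
    case False
    define r where "r = enn2real p"
    define I where "I = (LINT x|M. norm (f x) powr r)"
    define J where "J = (LINT x|M. norm (g x) powr r)"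
    have IJ: "I \<ge> 0" "J \<ge> 0" by (auto simp: I_def J_def)
    have r: "1 \<le> r" using finite_exponent[OF p False] by (simp add: r_def)
    have int: "integrable M (\<lambda>x. norm (f x) powr r)" "integrable M (\<lambda>x. norm (g x) powr r)"
      using f g False by (simp_all add: Lp_def r_def)
    have le: "norm (f x + g x) powr r \<le> 2 powr r * (norm (f x) powr r + norm (g x) powr r)" for x
    proof -
      define m where "m = max (norm (f x)) (norm (g x))"
      have "norm (f x + g x) powr r \<le> (2 * m) powr r"
        using r norm_triangle_ineq[of "f x" "g x"] by (intro powr_mono2) (auto simp: m_def)
      also have "\<dots> = 2 powr r * m powr r" by (simp add: powr_mult m_def)
      also have "m powr r \<le> norm (f x) powr r + norm (g x) powr r" by (simp add: m_def max_def)
      finally show ?thesis by simp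
    qed
    have int': "integrable M (\<lambda>x. norm (f x + g x) powr r)"
    proof (rule Bochner_Integration.integrable_bound)
      show "integrable M (\<lambda>x. 2 powr r * (norm (f x) powr r + norm (g x) powr r))" using int by simp
      show "AE x in M. norm (norm (f x + g x) powr r) \<le> norm (2 powr r * (norm (f x) powr r + norm (g x) powr r))"
        using le by simp
    qed measurable
    have "(LINT x|M. norm (f x + g x) powr r) \<le> (LINT x|M. 2 powr r * (norm (f x) powr r + norm (g x) powr r))"
      using int int' le by (intro integral_mono) auto
    also have "\<dots> = 2 powr r * (I + J)" using int by (simp add: I_def J_def)
    finally have "(LINT x|M. norm (f x + g x) powr r) powr (1 / r) \<le> (2 powr r * (I + J)) powr (1 / r)"
      using r by (intro powr_mono2) auto
    also have "\<dots> = 2 * (I + J) powr (1 / r)" using r IJ by (simp add: powr_mult powr_powr)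
    also have "(I + J) powr (1 / r) \<le> 2 * (I powr (1 / r) + J powr (1 / r))"
    proof -
      define m where "m = max I J"
      have "(I + J) powr (1 / r) \<le> (2 * m) powr (1 / r)" using r IJ by (intro powr_mono2) (auto simp: m_def)
      also have "\<dots> = 2 powr (1 / r) * m powr (1 / r)" using IJ by (simp add: powr_mult m_def max_def)
      also have "\<dots> \<le> 2 powr 1 * (I powr (1 / r) + J powr (1 / r))"
        using r by (intro mult_mono powr_mono) (auto simp: m_def max_def)
      finally show ?thesis by simp
    qed
    finally show ?thesis using int' False by (simp add: Lp_def Lp_norm_def r_def I_def J_def)
  qed
  then show "(\<lambda>x. f x + g x) \<in> Lp p M"
    "Lp_norm p M (\<lambda>x. f x + g x) \<le> 4 * (Lp_norm p M f + Lp_norm p M g)" by auto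
qed

lemma Lp_lin:
  fixes f g :: "'a \<Rightarrow> complex"
  assumes p: "1 \<le> p" and f: "f \<in> Lp p M" and g: "g \<in> Lp p M"
  shows "(\<lambda>x. c * f x + d * g x) \<in> Lp p M"
proof (intro Lp_add p)
  note [measurable] = Lp_measurable[OF f] Lp_measurable[OF g]
  show "(\<lambda>x. c * f x) \<in> Lp p M"
    by (rule Lp_dominated(1)[OF p f, of _ "cmod c"]) (auto simp: norm_mult)
  show "(\<lambda>x. d * g x) \<in> Lp p M"
    by (rule Lp_dominated(1)[OF p g, of _ "cmod d"]) (auto simp: norm_mult)
qed

lemma Lp_norm_eq_0_AE:
  assumes p: "1 \<le> p" and f: "f \<in> Lp p M" and 0: "Lp_norm p M f = 0"
  shows "AE x in M. f x = 0"
proof (cases "p = \<infinity>")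
  case True
  show ?thesis using Linf_AE_le_norm[OF f[unfolded True]] 0 True by simp
next
  case False
  define r where "r = enn2real p"
  have int: "integrable M (\<lambda>x. norm (f x) powr r)" using f False by (simp add: Lp_def r_def)
  have "(LINT x|M. norm (f x) powr r) = 0" using 0 False by (simp add: Lp_norm_def r_def)
  then have "AE x in M. norm (f x) powr r = 0"
    using integral_nonneg_eq_0_iff_AE[OF int] by simp
  then show ?thesis by eventually_elim simp
qed

lemma AE_0_Lp_norm:
  assumes "1 \<le> p" "f \<in> Lp p M" "AE x in M. f x = 0" shows "Lp_norm p M f = 0"
proof -
  have "AE x in M. norm (f x) \<le> 0 * norm (f x)" using assms(3) by eventually_elim simp
  from Lp_dominated(2)[OF assms(1,2) Lp_measurable[OF assms(2)] this]
  show ?thesis using Lp_norm_nonneg[of p M f] by simp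
qed

section \<open>Conjugate exponents, the pairing with m, sigma-finiteness\<close>

text \<open>In \<open>ennreal\<close>, \<open>1 / \<infinity> = 0\<close> and
  \<open>1 / 0 = \<infinity>\<close>, so the endpoint pairs obey the same equation, and it excludes
  \<open>q = 0\<close>.\<close>

lemma conjugate_exponent_cases:
  fixes p q :: ennreal
  assumes "1 \<le> p" and pq: "1 / p + 1 / q = 1"
  obtains (inf) "p = \<infinity>" "q = 1" | (one) "p = 1" "q = \<infinity>"
    | (finite) r s where "p = ennreal r" "q = ennreal s" "1 < r" "1 < s" "1 / r + 1 / s = 1"
proof (cases p)
  case top
  then have "1 / q = 1" using pq by (simp add: infinity_ennreal_def)
  have "q = 1"
  proof (cases q)
    case (real s)
    moreover have "s \<noteq> 0"
    proof
      assume "s = 0"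
      then have "1 / q = \<infinity>" using real by (simp add: divide_ennreal_def)
      then show False using \<open>1 / q = 1\<close> by simp
    qed
    ultimately have "ennreal (1 / s) = ennreal 1" using \<open>1 / q = 1\<close> divide_ennreal[of 1 s] by simp
    then show ?thesis using real by (subst (asm) ennreal_inj) auto
  qed (use \<open>1 / q = 1\<close> in \<open>simp add: infinity_ennreal_def\<close>)
  then show thesis using top inf by simp
next
  case p: (real r)
  then have r: "1 \<le> r" using assms(1) by simp
  have ip: "1 / p = ennreal (1 / r)" using r p divide_ennreal[of 1 r] by simp
  show thesis
  proof (cases q)
    case top
    then have "ennreal (1 / r) = ennreal 1" using pq ip by (simp add: infinity_ennreal_def)
    then have "1 / r = 1" using r by (subst (asm) ennreal_inj) auto
    then show thesis using one p top by simp
  next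
    case q: (real s)
    have s: "s \<noteq> 0"
    proof
      assume "s = 0"
      then have "1 / q = \<infinity>" using q by (simp add: divide_ennreal_def)
      then show False using pq by simp
    qed
    then have "1 / q = ennreal (1 / s)" using q divide_ennreal[of 1 s] by simp
    then have "ennreal (1 / r + 1 / s) = ennreal 1" using pq ip r q by (simp add: ennreal_plus)
    then have eq: "1 / r + 1 / s = 1" using r q by (subst (asm) ennreal_inj) auto
    moreover have "0 < 1 / s" "0 < 1 / r" using r s q by auto
    ultimately have "1 / r < 1" "1 / s < 1" by linarith+
    then have "1 < r" "1 < s" using r s q by (auto simp: divide_less_eq)
    then show thesis using finite p q eq by blast
  qed
qed

lemma Lp_pairing:
  fixes m :: "'a \<Rightarrow> real"
  assumes p: "1 \<le> p" and pq: "1 / p + 1 / q = 1" and m: "m \<in> Lp q M"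
  obtains C where "0 \<le> C"
    "\<And>\<phi> :: 'a \<Rightarrow> complex. \<phi> \<in> Lp p M \<Longrightarrow> integrable M (\<lambda>x. \<phi> x * of_real (m x))"
    "\<And>\<phi> :: 'a \<Rightarrow> complex. \<phi> \<in> Lp p M \<Longrightarrow> (LINT x|M. cmod (\<phi> x * of_real (m x))) \<le> C * Lp_norm p M \<phi>"
proof -
  note [measurable] = Lp_measurable[OF m]
  have "\<exists>C\<ge>0. \<forall>\<phi> :: 'a \<Rightarrow> complex. \<phi> \<in> Lp p M \<longrightarrow> integrable M (\<lambda>x. \<phi> x * of_real (m x)) \<and>
    (LINT x|M. cmod (\<phi> x * of_real (m x))) \<le> C * Lp_norm p M \<phi>"
    using p pq
  proof (cases rule: conjugate_exponent_cases)
    case inf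
    have mi: "integrable M (\<lambda>x. \<bar>m x\<bar>)" using m inf by (simp add: Lp_def)
    show ?thesis
    proof (intro exI[of _ "LINT x|M. \<bar>m x\<bar>"] conjI allI impI)
      fix \<phi> :: "'a \<Rightarrow> complex" assume \<phi>: "\<phi> \<in> Lp p M"
      note [measurable] = Lp_measurable[OF \<phi>]
      have le: "AE x in M. cmod (\<phi> x * of_real (m x)) \<le> Lp_norm p M \<phi> * \<bar>m x\<bar>"
        using Linf_AE_le_norm[OF \<phi>[unfolded inf(1)]]
        by eventually_elim (auto simp: norm_mult inf intro: mult_right_mono)
      show *: "integrable M (\<lambda>x. \<phi> x * of_real (m x))"
      proof (rule Bochner_Integration.integrable_bound)
        show "integrable M (\<lambda>x. Lp_norm p M \<phi> * \<bar>m x\<bar>)" using mi by simp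
        show "AE x in M. norm (\<phi> x * of_real (m x)) \<le> norm (Lp_norm p M \<phi> * \<bar>m x\<bar>)"
          using le by eventually_elim simp
      qed measurable
      have "(LINT x|M. cmod (\<phi> x * of_real (m x))) \<le> (LINT x|M. Lp_norm p M \<phi> * \<bar>m x\<bar>)"
        using le mi * by (intro integral_mono_AE) (auto intro: integrable_norm)
      then show "(LINT x|M. cmod (\<phi> x * of_real (m x))) \<le> (LINT x|M. \<bar>m x\<bar>) * Lp_norm p M \<phi>"
        by (simp add: mult.commute)
    qed auto
  next
    case one
    show ?thesis
    proof (intro exI[of _ "Lp_norm q M m"] conjI allI impI)
      fix \<phi> :: "'a \<Rightarrow> complex" assume \<phi>: "\<phi> \<in> Lp p M"
      note [measurable] = Lp_measurable[OF \<phi>]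
      have \<phi>i: "integrable M (\<lambda>x. cmod (\<phi> x))" using \<phi> one by (simp add: Lp_def)
      have le: "AE x in M. cmod (\<phi> x * of_real (m x)) \<le> Lp_norm q M m * cmod (\<phi> x)"
        using Linf_AE_le_norm[OF m[unfolded one(2)]]
        by eventually_elim (auto simp: norm_mult one mult.commute[of "cmod _"] intro: mult_right_mono)
      show *: "integrable M (\<lambda>x. \<phi> x * of_real (m x))"
      proof (rule Bochner_Integration.integrable_bound)
        show "integrable M (\<lambda>x. Lp_norm q M m * cmod (\<phi> x))" using \<phi>i by simp
        show "AE x in M. norm (\<phi> x * of_real (m x)) \<le> norm (Lp_norm q M m * cmod (\<phi> x))"
          using le by eventually_elim simp
      qed measurable
      have "(LINT x|M. cmod (\<phi> x * of_real (m x))) \<le> (LINT x|M. Lp_norm q M m * cmod (\<phi> x))"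
        using le \<phi>i * by (intro integral_mono_AE) (auto intro: integrable_norm)
      then show "(LINT x|M. cmod (\<phi> x * of_real (m x))) \<le> Lp_norm q M m * Lp_norm p M \<phi>"
        by (simp add: Lp_norm_def[of 1] one)
    qed (rule Lp_norm_nonneg)
  next
    case (finite r s)
    have er: "enn2real p = r" "enn2real q = s" "p \<noteq> \<infinity>" "q \<noteq> \<infinity>" using finite by auto
    define J where "J = (LINT x|M. \<bar>m x\<bar> powr s)"
    have mi: "integrable M (\<lambda>x. \<bar>m x\<bar> powr s)" using m er by (simp add: Lp_def)
    \<comment> \<open>Young's inequality is not homogeneous in \<phi>. Rescaling \<phi> to norm 1
      turns it into a bound linear in the norm, with constant
      \<open>1 / r + J / s \<le> 1 + J\<close>.\<close>
    have young: "integrable M (\<lambda>x. \<phi> x * of_real (m x)) \<and>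
        (LINT x|M. cmod (\<phi> x * of_real (m x))) \<le> (LINT x|M. cmod (\<phi> x) powr r) / r + J / s"
      if \<phi>: "\<phi> \<in> Lp p M" for \<phi> :: "'a \<Rightarrow> complex"
    proof
      note [measurable] = Lp_measurable[OF \<phi>]
      have \<phi>i: "integrable M (\<lambda>x. cmod (\<phi> x) powr r)" using \<phi> er by (simp add: Lp_def)
      have le: "cmod (\<phi> x * of_real (m x)) \<le> cmod (\<phi> x) powr r / r + \<bar>m x\<bar> powr s / s" for x
        unfolding norm_mult norm_of_real using finite by (intro Youngs_inequality) auto
      show *: "integrable M (\<lambda>x. \<phi> x * of_real (m x))"
      proof (rule Bochner_Integration.integrable_bound)
        show "integrable M (\<lambda>x. cmod (\<phi> x) powr r / r + \<bar>m x\<bar> powr s / s)" using \<phi>i mi by simp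
        show "AE x in M. norm (\<phi> x * of_real (m x)) \<le> norm (cmod (\<phi> x) powr r / r + \<bar>m x\<bar> powr s / s)"
          using order_trans[OF le abs_ge_self] by simp
      qed measurable
      have "(LINT x|M. cmod (\<phi> x * of_real (m x))) \<le> (LINT x|M. cmod (\<phi> x) powr r / r + \<bar>m x\<bar> powr s / s)"
        using le \<phi>i mi * by (intro integral_mono) (auto intro: integrable_norm)
      then show "(LINT x|M. cmod (\<phi> x * of_real (m x))) \<le> (LINT x|M. cmod (\<phi> x) powr r) / r + J / s"
        using \<phi>i mi by (simp add: J_def)
    qed
    have J0: "0 \<le> J" by (simp add: J_def)
    show ?thesis
    proof (intro exI[of _ "1 + J"] conjI allI impI)
      fix \<phi> :: "'a \<Rightarrow> complex" assume \<phi>: "\<phi> \<in> Lp p M"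
      show "integrable M (\<lambda>x. \<phi> x * of_real (m x))" using young[OF \<phi>] by simp
      define n where "n = Lp_norm p M \<phi>"
      show "(LINT x|M. cmod (\<phi> x * of_real (m x))) \<le> (1 + J) * Lp_norm p M \<phi>"
      proof (cases "n = 0")
        case True
        then have "AE x in M. cmod (\<phi> x * of_real (m x)) = 0"
          using Lp_norm_eq_0_AE[OF p \<phi>] by (auto simp: n_def)
        then have "(LINT x|M. cmod (\<phi> x * of_real (m x))) = 0" by (rule integral_eq_zero_AE)
        then show ?thesis using J0 Lp_norm_nonneg[of p M \<phi>] by simp
      next
        case False
        then have n: "n > 0" using Lp_norm_nonneg[of p M \<phi>] by (simp add: n_def)
        define I where "I = (LINT x|M. cmod (\<phi> x) powr r)"
        have nI: "n = I powr (1 / r)" using er(3) by (auto simp: n_def Lp_norm_def I_def er(1))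
        have "I \<ge> 0" by (simp add: I_def)
        then have "n powr r = I" using finite by (simp add: nI powr_powr)
        define \<psi> where "\<psi> x = of_real (1 / n) * \<phi> x + 0 * \<phi> x" for x
        have \<psi>: "\<psi> \<in> Lp p M" unfolding \<psi>_def[abs_def] by (rule Lp_lin[OF p \<phi> \<phi>])
        have np: "cmod (\<psi> x) = cmod (\<phi> x) / n" for x using n by (simp add: \<psi>_def norm_mult norm_divide)
        have "(LINT x|M. cmod (\<psi> x) powr r) = I / n powr r"
          unfolding np I_def using n by (simp add: powr_divide)
        also have "\<dots> = 1" using \<open>n powr r = I\<close> n by (metis divide_self_if powr_eq_0_iff less_irrefl)
        finally have 1: "(LINT x|M. cmod (\<psi> x) powr r) = 1" .
        have "(LINT x|M. cmod (\<phi> x * of_real (m x))) / n = (LINT x|M. cmod (\<psi> x * of_real (m x)))"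
          unfolding norm_mult np by simp
        also have "\<dots> \<le> 1 / r + J / s" using young[OF \<psi>] by (simp add: 1)
        also have "\<dots> \<le> 1 + J"
        proof -
          have "J / s \<le> J / 1" using finite J0 by (intro divide_left_mono) auto
          moreover have "1 / r \<le> 1" using finite by simp
          ultimately show ?thesis by simp
        qed
        finally show ?thesis using n by (simp add: divide_le_eq n_def)
      qed
    qed (use J0 in simp)
  qed
  then show thesis using that by blast
qed

text \<open>By Markov's inequality the sets where \<open>f \<ge> 1 / (n + 1)\<close> have finite
  measure; they exhaust the space up to the null set where \<open>f\<close> is not positive.\<close>

lemma sigma_finite_measure_if_pos_integrable:
  fixes f :: "'a \<Rightarrow> real"
  assumes [measurable]: "f \<in> borel_measurable M" and pos: "AE x in M. f x > 0"
    and fin: "(\<integral>\<^sup>+ x. ennreal (f x) \<partial>M) < \<infinity>"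
  shows "sigma_finite_measure M"
proof
  define A where "A n = {x \<in> space M. 1 \<le> ennreal (real (Suc n)) * ennreal (f x)}" for n
  define Z where "Z = {x \<in> space M. \<not> f x > 0}"
  have Am: "A n \<in> sets M" for n unfolding A_def by measurable
  have Z: "Z \<in> sets M" unfolding Z_def by measurable
  have Z0: "emeasure M Z = 0" using pos by (subst (asm) AE_iff_measurable[of Z]) (use Z in \<open>auto simp: Z_def\<close>)
  have A_fin: "emeasure M (A n) \<noteq> \<infinity>" for n
  proof -
    have "emeasure M (A n) \<le> ennreal (real (Suc n)) * (\<integral>\<^sup>+ x. ennreal (f x) * indicator (space M) x \<partial>M)"
      unfolding A_def by (rule nn_integral_Markov_inequality) measurable
    also have "(\<integral>\<^sup>+ x. ennreal (f x) * indicator (space M) x \<partial>M) = (\<integral>\<^sup>+ x. ennreal (f x) \<partial>M)"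
      by (intro nn_integral_cong) auto
    also have "ennreal (real (Suc n)) * \<dots> < \<infinity>"
      using fin by (simp add: ennreal_mult_less_top)
    finally show ?thesis by simp
  qed
  have "space M \<subseteq> \<Union> (insert Z (range A))"
  proof
    fix x assume x: "x \<in> space M"
    show "x \<in> \<Union> (insert Z (range A))"
    proof (cases "f x > 0")
      case True
      then obtain n where "1 / f x < real n" using reals_Archimedean2 by blast
      then have "1 \<le> real (Suc n) * f x" using True by (simp add: divide_less_eq distrib_right)
      then have "ennreal 1 \<le> ennreal (real (Suc n) * f x)" by (rule ennreal_leI)
      then have "x \<in> A n" using x True by (simp add: A_def ennreal_mult)
      then show ?thesis by blast
    qed (use x in \<open>simp add: Z_def\<close>)
  qed
  moreover have "\<Union> (insert Z (range A)) \<subseteq> space M" by (auto simp: A_def Z_def)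
  ultimately show "\<exists>A. countable A \<and> A \<subseteq> sets M \<and> \<Union> A = space M \<and> (\<forall>a\<in>A. emeasure M a \<noteq> \<infinity>)"
    using Am Z Z0 A_fin by (intro exI[of _ "insert Z (range A)"]) auto
qed

section \<open>Operators factoring through bounded functions\<close>

text \<open>
  \<open>T = h J\<close> where \<open>J\<close> maps \<open>L\<^sup>p\<close> into the bounded functions, and \<open>J h = N\<close>. Thus a resolvent
  \<open>R\<close> of \<open>N\<close> gives the resolvent \<open>(1 + h R J) / z\<close> of \<open>T\<close>.
\<close>

locale factored_operator =
  K: sector_kernel "density M (\<lambda>x. ennreal (h x * m x))" k b A D + sigma_finite_measure M
  for M :: "'a measure" and h m :: "'a \<Rightarrow> real" and k b A D +
  fixes p :: ennreal and C :: real and T :: "('a \<Rightarrow> complex) \<Rightarrow> 'a \<Rightarrow> complex"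
  assumes p: "1 \<le> p"
    and h: "h \<in> Lp p M" and h_pos: "AE x in M. 0 < h x"
    and m_measurable [measurable]: "m \<in> borel_measurable M" and m_pos: "AE x in M. 0 < m x"
    and C: "0 \<le> C"
    and pairing_integrable: "\<And>\<phi> :: 'a \<Rightarrow> complex. \<phi> \<in> Lp p M \<Longrightarrow> integrable M (\<lambda>x. \<phi> x * of_real (m x))"
    and pairing_bound: "\<And>\<phi> :: 'a \<Rightarrow> complex. \<phi> \<in> Lp p M \<Longrightarrow>
      (LINT x|M. cmod (\<phi> x * of_real (m x))) \<le> C * Lp_norm p M \<phi>"
    and T_measurable: "\<And>\<phi>. \<phi> \<in> Lp p M \<Longrightarrow> T \<phi> \<in> borel_measurable M"
    and T_eq: "\<And>\<phi>. \<phi> \<in> Lp p M \<Longrightarrow>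
      AE x in M. T \<phi> x = of_real (h x) * (LINT y|M. k x y * (\<phi> y * of_real (m y)))"
begin

section \<open>Transfer between \<open>L^p\<close> and bounded functions\<close>

definition J :: "('a \<Rightarrow> complex) \<Rightarrow> 'a \<Rightarrow> complex" where
  "J \<phi> = (\<lambda>x. LINT y|M. k x y * (\<phi> y * of_real (m y)))"

lemma h_measurable [measurable]: "h \<in> borel_measurable M"
  using h by (rule Lp_measurable)

lemma k_section_M [measurable]: "k x \<in> borel_measurable M"
  using K.k_section[of x] by simp

lemma k_measurable_M [measurable]: "case_prod k \<in> borel_measurable (M \<Otimes>\<^sub>M M)"
proof -
  have "sets (density M (\<lambda>x. ennreal (h x * m x)) \<Otimes>\<^sub>M density M (\<lambda>x. ennreal (h x * m x))) = sets (M \<Otimes>\<^sub>M M)"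
    by (intro sets_pair_measure_cong) auto
  then show ?thesis using K.k_measurable by (simp cong: measurable_cong_sets)
qed

lemma K_B_measurable [measurable_dest]: "\<psi> \<in> K.B \<Longrightarrow> \<psi> \<in> borel_measurable M"
  using K.B_measurable[of \<psi>] by simp

lemma T_eq_J: "\<phi> \<in> Lp p M \<Longrightarrow> AE x in M. T \<phi> x = of_real (h x) * J \<phi> x"
  using T_eq by (simp add: J_def)

lemma J_integrable: assumes "\<phi> \<in> Lp p M" shows "integrable M (\<lambda>y. k x y * (\<phi> y * of_real (m y)))"
proof (rule Bochner_Integration.integrable_bound)
  note [measurable] = Lp_measurable[OF assms]
  show "integrable M (\<lambda>y. of_real b * (\<phi> y * of_real (m y)))"
    by (intro integrable_mult_right pairing_integrable assms)
  show "AE y in M. norm (k x y * (\<phi> y * of_real (m y))) \<le> norm (of_real b * (\<phi> y * of_real (m y)))"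
  proof (rule AE_I2)
    fix y
    have "cmod (k x y) \<le> \<bar>b\<bar>" using K.k_bound[of x y] by linarith
    then show "norm (k x y * (\<phi> y * of_real (m y))) \<le> norm (of_real b * (\<phi> y * of_real (m y)))"
      unfolding norm_mult[of "k x y"] norm_mult[of "of_real b"] norm_of_real by (intro mult_right_mono) auto
  qed
  have "(\<lambda>y. \<phi> y * of_real (m y)) \<in> borel_measurable M" by measurable
  then show "(\<lambda>y. k x y * (\<phi> y * of_real (m y))) \<in> borel_measurable M"
    by (rule borel_measurable_times[OF k_section_M])
qed

lemma J_bound: assumes \<phi>: "\<phi> \<in> Lp p M" shows "cmod (J \<phi> x) \<le> b * C * Lp_norm p M \<phi>"
proof -
  have "cmod (J \<phi> x) \<le> (LINT y|M. cmod (k x y * (\<phi> y * of_real (m y))))"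
    unfolding J_def by (rule integral_norm_bound)
  also have "\<dots> \<le> (LINT y|M. b * cmod (\<phi> y * of_real (m y)))"
    using J_integrable[OF \<phi>, of x] pairing_integrable[OF \<phi>] K.k_bound
    by (intro integral_mono integrable_mult_right integrable_norm)
      (auto simp: norm_mult[of "k x _"] intro: mult_right_mono)
  also have "\<dots> = b * (LINT y|M. cmod (\<phi> y * of_real (m y)))" by (rule integral_mult_right_zero)
  also have "\<dots> \<le> b * (C * Lp_norm p M \<phi>)"
    using K.b_pos by (intro mult_left_mono pairing_bound \<phi>) auto
  finally show ?thesis by (simp only: mult.assoc)
qed

lemma J_B: assumes \<phi>: "\<phi> \<in> Lp p M" shows "J \<phi> \<in> K.B"
proof (rule K.BI[OF _ J_bound[OF \<phi>]])
  note [measurable] = Lp_measurable[OF \<phi>]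
  have "J \<phi> \<in> borel_measurable M" unfolding J_def by measurable
  then show "J \<phi> \<in> borel_measurable (density M (\<lambda>x. ennreal (h x * m x)))" by simp
qed

lemma J_lin:
  assumes "\<phi> \<in> Lp p M" "\<psi> \<in> Lp p M"
  shows "J (\<lambda>x. c * \<phi> x + d * \<psi> x) x = c * J \<phi> x + d * J \<psi> x"
proof -
  have "J (\<lambda>x. c * \<phi> x + d * \<psi> x) x
      = (LINT y|M. c * (k x y * (\<phi> y * of_real (m y))) + d * (k x y * (\<psi> y * of_real (m y))))"
    unfolding J_def by (intro Bochner_Integration.integral_cong refl) (simp add: algebra_simps)
  also have "\<dots> = c * J \<phi> x + d * J \<psi> x"
    unfolding J_def using J_integrable[OF assms(1), of x] J_integrable[OF assms(2), of x] by simp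
  finally show ?thesis .
qed

text \<open>The integral ignores null sets, so \<open>J\<close> turns equations almost everywhere
  into equations at every point, the setting in which \<open>N\<close> is studied.\<close>

lemma J_cong:
  assumes "\<phi> \<in> borel_measurable M" "\<psi> \<in> borel_measurable M" "AE x in M. \<phi> x = \<psi> x"
  shows "J \<phi> x = J \<psi> x"
  unfolding J_def
proof (rule integral_cong_AE)
  note [measurable] = assms(1,2)
  show "(\<lambda>y. k x y * (\<phi> y * of_real (m y))) \<in> borel_measurable M" by measurable
  show "(\<lambda>y. k x y * (\<psi> y * of_real (m y))) \<in> borel_measurable M" by measurable
qed (use assms(3) in \<open>eventually_elim, simp\<close>)

lemma hB_Lp:
  assumes \<psi>: "\<psi> \<in> K.B" and R: "\<And>x. cmod (\<psi> x) \<le> R"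
  shows "(\<lambda>x. of_real (h x) * \<psi> x) \<in> Lp p M" "Lp_norm p M (\<lambda>x. of_real (h x) * \<psi> x) \<le> R * Lp_norm p M h"
proof -
  note [measurable] = K_B_measurable[OF \<psi>]
  have "0 \<le> R" using R norm_ge_zero order_trans by blast
  moreover have "AE x in M. norm (of_real (h x) * \<psi> x) \<le> R * norm (h x)"
    by (intro AE_I2) (simp add: norm_mult mult.commute[of R] mult_left_mono R)
  moreover have "(\<lambda>x. of_real (h x) * \<psi> x) \<in> borel_measurable M" by measurable
  ultimately show "(\<lambda>x. of_real (h x) * \<psi> x) \<in> Lp p M" "Lp_norm p M (\<lambda>x. of_real (h x) * \<psi> x) \<le> R * Lp_norm p M h"
    using Lp_dominated[OF p h] by blast+
qed

lemma hB: "\<psi> \<in> K.B \<Longrightarrow> (\<lambda>x. of_real (h x) * \<psi> x) \<in> Lp p M"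
  by (metis K.B_bound hB_Lp(1))

text \<open>Of the density \<open>h m\<close>, the factor \<open>m\<close> belongs to
  \<open>J\<close> and \<open>h\<close> is supplied by the argument.\<close>

lemma J_h: assumes \<psi>: "\<psi> \<in> K.B" shows "J (\<lambda>x. of_real (h x) * \<psi> x) x = K.N \<psi> x"
proof -
  note [measurable] = K_B_measurable[OF \<psi>]
  have nn: "AE y in M. 0 \<le> h y * m y" using h_pos m_pos by eventually_elim simp
  have "K.N \<psi> x = (LINT y|M. (h y * m y) *\<^sub>R (k x y * \<psi> y))"
    unfolding K.N_def using nn by (intro integral_density) measurable
  also have "\<dots> = J (\<lambda>x. of_real (h x) * \<psi> x) x"
    unfolding J_def by (intro Bochner_Integration.integral_cong refl) (simp add: scaleR_conv_of_real mult_ac)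
  finally show ?thesis by simp
qed

lemma T_Lp: assumes \<phi>: "\<phi> \<in> Lp p M"
  shows "T \<phi> \<in> Lp p M" "Lp_norm p M (T \<phi>) \<le> b * C * Lp_norm p M h * Lp_norm p M \<phi>"
proof -
  have 1: "AE x in M. norm (T \<phi> x) \<le> b * C * Lp_norm p M \<phi> * norm (h x)"
    using T_eq_J[OF \<phi>]
    by eventually_elim (auto simp: norm_mult mult.commute[of _ "\<bar>h _\<bar>"] intro: mult_left_mono J_bound[OF \<phi>])
  have 2: "0 \<le> b * C * Lp_norm p M \<phi>" using K.b_pos C by (simp add: Lp_norm_nonneg)
  show "T \<phi> \<in> Lp p M" "Lp_norm p M (T \<phi>) \<le> b * C * Lp_norm p M h * Lp_norm p M \<phi>"
    using Lp_dominated[OF p h T_measurable[OF \<phi>] 1 2] by (simp_all add: mult_ac)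
qed

lemma T_bounded_op: "Lp_bounded_op p M T"
  unfolding Lp_bounded_op_def
proof (intro conjI ballI allI)
  show "T \<phi> \<in> Lp p M" if "\<phi> \<in> Lp p M" for \<phi> by (rule T_Lp[OF that])
  fix \<phi> \<psi> :: "'a \<Rightarrow> complex" and c d assume \<phi>: "\<phi> \<in> Lp p M" and \<psi>: "\<psi> \<in> Lp p M"
  show "AE x in M. T (\<lambda>y. c * \<phi> y + d * \<psi> y) x = c * T \<phi> x + d * T \<psi> x"
    using T_eq_J[OF Lp_lin[OF p \<phi> \<psi>, of c d]] T_eq_J[OF \<phi>] T_eq_J[OF \<psi>]
    by eventually_elim (simp add: J_lin[OF \<phi> \<psi>] algebra_simps)
next
  show "\<exists>B. \<forall>\<phi>\<in>Lp p M. Lp_norm p M (T \<phi>) \<le> B * Lp_norm p M \<phi>" using T_Lp(2) by blast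
qed

lemma J_T: assumes \<phi>: "\<phi> \<in> Lp p M" shows "J (T \<phi>) x = K.N (J \<phi>) x"
proof -
  have "J (T \<phi>) x = J (\<lambda>x. of_real (h x) * J \<phi> x) x"
    using T_eq_J[OF \<phi>] by (intro J_cong T_measurable \<phi> Lp_measurable[OF hB[OF J_B[OF \<phi>]]])
  then show ?thesis by (simp add: J_h[OF J_B[OF \<phi>]])
qed

lemma J_resolvent_arg:
  assumes \<phi>: "\<phi> \<in> Lp p M" shows "J (\<lambda>y. z * \<phi> y - T \<phi> y) x = z * J \<phi> x - K.N (J \<phi>) x"
  using J_lin[OF \<phi> T_Lp(1)[OF \<phi>], of z "- 1" x] by (simp add: J_T[OF \<phi>])

lemma resolvent_arg_Lp: assumes \<phi>: "\<phi> \<in> Lp p M" shows "(\<lambda>y. z * \<phi> y - T \<phi> y) \<in> Lp p M"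
  using Lp_lin[OF p \<phi> T_Lp(1)[OF \<phi>], of z "- 1"] by simp

lemma solution_unique:
  assumes z: "K.\<rho> < cmod z" "z \<noteq> K.lam" and w: "w \<in> K.B" "w' \<in> K.B"
    and eq: "\<And>x. z * w x - K.N w x = z * w' x - K.N w' x"
  shows "w = w'"
proof
  fix x
  define u where "u x = 1 * w x + (- 1) * w' x" for x
  have uB: "u \<in> K.B" unfolding u_def[abs_def] by (rule K.B_lin[OF w])
  have "K.N u x = z * u x" for x
    unfolding u_def[abs_def] K.N_lin[OF w] using eq[of x] by (simp add: algebra_simps)
  then have "u x = 0" using K.eigenfunction_unique[OF uB z(1), of x] z(2) by simp
  then show "w x = w' x" by (simp add: u_def)
qed

lemma resolvent_set:
  assumes z: "K.\<rho> < cmod z" "z \<noteq> K.lam"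
  shows "z \<in> Lp_resolvent_set p M T"
proof -
  have z0: "z \<noteq> 0" using z K.rho by auto
  obtain Kz where Kz: "\<And>g R. g \<in> K.B \<Longrightarrow> R > 0 \<Longrightarrow> (\<forall>x. cmod (g x) \<le> R) \<Longrightarrow>
      \<exists>w\<in>K.B. (\<forall>x. z * w x - K.N w x = g x) \<and> (\<forall>x. cmod (w x) \<le> Kz * R)"
    using K.resolvent[OF z] by blast
  \<comment> \<open>An arbitrary choice of solution, but \<open>solution_unique\<close> leaves only
    one; hence linearity and the bound.\<close>
  define R where "R g = (SOME w. w \<in> K.B \<and> (\<forall>x. z * w x - K.N w x = g x))" for g
  have R: "R g \<in> K.B" "z * R g x - K.N (R g) x = g x" if g: "g \<in> K.B" for g x
  proof -
    obtain r where r: "r > 0" "\<And>x. cmod (g x) \<le> r" using K.B_bound[OF g] by blast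
    have "\<exists>w. w \<in> K.B \<and> (\<forall>x. z * w x - K.N w x = g x)" using Kz[OF g, of r] r by blast
    from someI_ex[OF this] show "R g \<in> K.B" "z * R g x - K.N (R g) x = g x"
      unfolding R_def[symmetric] by auto
  qed
  have R_unique: "R g = w" if "g \<in> K.B" "w \<in> K.B" "\<And>x. z * w x - K.N w x = g x" for g w
    by (rule solution_unique[OF z R(1)[OF that(1)] that(2)]) (simp only: R(2)[OF that(1)] that(3))
  have R_bound: "cmod (R g x) \<le> Kz * r" if g: "g \<in> K.B" "\<And>x. cmod (g x) \<le> r" for g r x
  proof (cases "r > 0")
    case True
    then obtain w where w: "w \<in> K.B" "\<And>x. z * w x - K.N w x = g x" "\<And>x. cmod (w x) \<le> Kz * r"
      using Kz[OF g(1) True] g(2) by blast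
    then show ?thesis using R_unique[OF g(1) w(1,2)] by simp
  next
    \<comment> \<open>Here \<open>g = 0\<close>. The case arises when the bound supplied by
      \<open>J_bound\<close> is 0.\<close>
    case False
    have "r = 0" using False g(2)[of x] norm_ge_zero[of "g x"] by linarith
    then have "g x = 0" for x using g(2)[of x] by simp
    then have "R g = (\<lambda>_. 0)" by (intro R_unique g K.B_const) (simp add: K.N_def)
    then show ?thesis by (simp add: \<open>r = 0\<close>)
  qed
  have R_lin: "R (\<lambda>x. c * f x + d * g x) = (\<lambda>x. c * R f x + d * R g x)"
    if f: "f \<in> K.B" and g: "g \<in> K.B" for f g c d
  proof (rule R_unique[OF K.B_lin[OF f g] K.B_lin[OF R(1)[OF f] R(1)[OF g]]])
    fix x
    have "z * (c * R f x + d * R g x) - (c * K.N (R f) x + d * K.N (R g) x)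
      = c * (z * R f x - K.N (R f) x) + d * (z * R g x - K.N (R g) x)"
      by (simp add: algebra_simps)
    then show "z * (c * R f x + d * R g x) - K.N (\<lambda>x. c * R f x + d * R g x) x = c * f x + d * g x"
      by (simp only: K.N_lin[OF R(1)[OF f] R(1)[OF g]] R(2)[OF f] R(2)[OF g])
  qed
  define S where "S \<phi> x = (1 / z) * \<phi> x + (1 / z) * (of_real (h x) * R (J \<phi>) x)" for \<phi> x
  have hR: "(\<lambda>x. of_real (h x) * R (J \<phi>) x) \<in> Lp p M"
    "Lp_norm p M (\<lambda>x. of_real (h x) * R (J \<phi>) x) \<le> Kz * (b * C * Lp_norm p M \<phi>) * Lp_norm p M h"
    if "\<phi> \<in> Lp p M" for \<phi>
    using hB_Lp[OF R(1)[OF J_B[OF that]] R_bound[OF J_B[OF that] J_bound[OF that]]] by auto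
  have S_Lp: "S \<phi> \<in> Lp p M" if "\<phi> \<in> Lp p M" for \<phi>
    unfolding S_def[abs_def] by (rule Lp_lin[OF p that hR(1)[OF that]])
  \<comment> \<open>\<open>J S = (J + N R J) / z = R J\<close>, because \<open>z R - N R\<close> is
    the identity. The right inverse property then reads
    \<open>z S - h J S = 1 + h R J - h R J = 1\<close>.\<close>
  have JS: "J (S \<phi>) = R (J \<phi>)" if \<phi>: "\<phi> \<in> Lp p M" for \<phi>
  proof
    fix x
    have "J (S \<phi>) x = (1 / z) * J \<phi> x + (1 / z) * K.N (R (J \<phi>)) x"
      unfolding S_def[abs_def] J_lin[OF \<phi> hR(1)[OF \<phi>]] J_h[OF R(1)[OF J_B[OF \<phi>]]] ..
    also have "J \<phi> x = z * R (J \<phi>) x - K.N (R (J \<phi>)) x" by (simp only: R(2)[OF J_B[OF \<phi>]])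
    also have "(1 / z) * (z * R (J \<phi>) x - K.N (R (J \<phi>)) x) + (1 / z) * K.N (R (J \<phi>)) x = R (J \<phi>) x"
      using z0 by (simp add: field_simps)
    finally show "J (S \<phi>) x = R (J \<phi>) x" .
  qed
  have "Lp_bounded_op p M S"
    unfolding Lp_bounded_op_def
  proof (intro conjI ballI allI)
    show "S \<phi> \<in> Lp p M" if "\<phi> \<in> Lp p M" for \<phi> by (rule S_Lp[OF that])
    fix \<phi> \<psi> :: "'a \<Rightarrow> complex" and c d assume \<phi>: "\<phi> \<in> Lp p M" and \<psi>: "\<psi> \<in> Lp p M"
    have "J (\<lambda>y. c * \<phi> y + d * \<psi> y) = (\<lambda>x. c * J \<phi> x + d * J \<psi> x)" using J_lin[OF \<phi> \<psi>] by blast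
    then have "R (J (\<lambda>y. c * \<phi> y + d * \<psi> y)) = (\<lambda>x. c * R (J \<phi>) x + d * R (J \<psi>) x)"
      using R_lin[OF J_B[OF \<phi>] J_B[OF \<psi>]] by simp
    then show "AE x in M. S (\<lambda>y. c * \<phi> y + d * \<psi> y) x = c * S \<phi> x + d * S \<psi> x"
      by (simp add: S_def algebra_simps)
  next
    define B1 where "B1 = 1 / cmod z"
    have "Lp_norm p M (S \<phi>) \<le> 4 * (B1 + B1 * (Kz * (b * C) * Lp_norm p M h)) * Lp_norm p M \<phi>"
      if \<phi>: "\<phi> \<in> Lp p M" for \<phi>
    proof -
      have scale: "(\<lambda>x. (1 / z) * f x) \<in> Lp p M \<and> Lp_norm p M (\<lambda>x. (1 / z) * f x) \<le> B1 * Lp_norm p M f"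
        if f: "f \<in> Lp p M" for f :: "'a \<Rightarrow> complex"
      proof -
        note [measurable] = Lp_measurable[OF f]
        have "(\<lambda>x. (1 / z) * f x) \<in> borel_measurable M" by measurable
        moreover have "AE x in M. norm ((1 / z) * f x) \<le> B1 * norm (f x)"
          by (simp add: B1_def norm_mult norm_divide)
        moreover have "0 \<le> B1" by (simp add: B1_def)
        ultimately show ?thesis using Lp_dominated[OF p f] by blast
      qed
      have B1: "0 \<le> B1" by (simp add: B1_def)
      have "Lp_norm p M (S \<phi>) \<le> 4 * (Lp_norm p M (\<lambda>x. (1 / z) * \<phi> x)
          + Lp_norm p M (\<lambda>x. (1 / z) * (of_real (h x) * R (J \<phi>) x)))"
        unfolding S_def[abs_def] using scale[OF \<phi>] scale[OF hR(1)[OF \<phi>]] by (intro Lp_add(2) p) auto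
      also have "\<dots> \<le> 4 * (B1 * Lp_norm p M \<phi> + B1 * (Kz * (b * C * Lp_norm p M \<phi>) * Lp_norm p M h))"
        using scale[OF \<phi>] order_trans[OF conjunct2[OF scale[OF hR(1)[OF \<phi>]]] mult_left_mono[OF hR(2)[OF \<phi>] B1]]
        by (intro mult_left_mono add_mono) auto
      finally show ?thesis by (simp add: algebra_simps)
    qed
    then show "\<exists>B. \<forall>\<phi>\<in>Lp p M. Lp_norm p M (S \<phi>) \<le> B * Lp_norm p M \<phi>" by blast
  qed
  moreover have "AE x in M. S (\<lambda>y. z * \<phi> y - T \<phi> y) x = \<phi> x" if \<phi>: "\<phi> \<in> Lp p M" for \<phi>
  proof -
    have RJ: "R (J (\<lambda>y. z * \<phi> y - T \<phi> y)) = J \<phi>"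
      by (intro R_unique J_B resolvent_arg_Lp \<phi>) (simp only: J_resolvent_arg[OF \<phi>])
    show ?thesis using T_eq_J[OF \<phi>]
      by eventually_elim (use z0 in \<open>simp add: S_def RJ flip: add_divide_distrib diff_divide_distrib\<close>)
  qed
  moreover have "AE x in M. z * S \<phi> x - T (S \<phi>) x = \<phi> x" if \<phi>: "\<phi> \<in> Lp p M" for \<phi>
    using T_eq_J[OF S_Lp[OF \<phi>]]
    by eventually_elim (use z0 in \<open>simp add: JS[OF \<phi>] S_def field_simps\<close>)
  ultimately show ?thesis unfolding Lp_resolvent_set_def by blast
qed

section \<open>The leading eigenvalue on \<open>L^p\<close>\<close>

definition V :: "'a \<Rightarrow> complex" where "V x = of_real (h x) * K.v x"

lemma V_Lp: "V \<in> Lp p M"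
  unfolding V_def[abs_def] by (rule hB[OF K.v(1)])

lemma J_V: "J V x = K.lam * K.v x"
  unfolding V_def[abs_def] J_h[OF K.v(1)] by (rule K.v(3))

lemma V_eigen: "AE x in M. T V x = K.lam * V x"
  using T_eq_J[OF V_Lp] by eventually_elim (simp add: J_V V_def)

lemma V_nonzero: "\<not> (AE x in M. V x = 0)"
proof
  assume "AE x in M. V x = 0"
  then have "J V x = J (\<lambda>_. 0) x" for x by (intro J_cong Lp_measurable[OF V_Lp]) auto
  then have "K.v x = 0" for x using J_V[of x] K.lam_nonzero by (simp add: J_def)
  then have "K.v = (\<lambda>x. 0 * K.v x + 0 * K.v x)" by auto
  then have "K.ell K.v = 0 * K.ell K.v + 0 * K.ell K.v" using K.ell_lin[OF K.v(1) K.v(1), of 0 0] by metis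
  then show False by (simp add: K.v(2))
qed

text \<open>A resolvent \<open>S\<close> would map \<open>lam V - T V\<close>, which is zero almost
  everywhere, to \<open>V\<close>. Boundedness preserves such functions although \<open>S\<close>
  acts on representatives, so \<open>V\<close> would be zero almost everywhere.\<close>

lemma lam_in_spectrum: "K.lam \<in> Lp_spectrum p M T"
proof -
  have False if res: "K.lam \<in> Lp_resolvent_set p M T"
  proof -
    obtain S where S: "Lp_bounded_op p M S" "AE x in M. S (\<lambda>y. K.lam * V y - T V y) x = V x"
      using res V_Lp unfolding Lp_resolvent_set_def by blast
    obtain B where B: "\<And>\<phi>. \<phi> \<in> Lp p M \<Longrightarrow> Lp_norm p M (S \<phi>) \<le> B * Lp_norm p M \<phi>"
      using S(1) unfolding Lp_bounded_op_def by blast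
    define f where "f = (\<lambda>y. K.lam * V y - T V y)"
    have f: "f \<in> Lp p M" unfolding f_def by (rule resolvent_arg_Lp[OF V_Lp])
    have "AE x in M. f x = 0" using V_eigen by eventually_elim (simp add: f_def)
    then have "Lp_norm p M f = 0" by (rule AE_0_Lp_norm[OF p f])
    then have "Lp_norm p M (S f) = 0" using B[OF f] Lp_norm_nonneg[of p M "S f"] by simp
    moreover have "S f \<in> Lp p M" using S(1) f by (simp add: Lp_bounded_op_def)
    ultimately have "AE x in M. S f x = 0" using Lp_norm_eq_0_AE[OF p] by blast
    then have "AE x in M. V x = 0" using S(2) unfolding f_def by eventually_elim simp
    then show False using V_nonzero by simp
  qed
  then show ?thesis by (auto simp: Lp_spectrum_def)
qed

text \<open>The composition of \<open>ell\<close> with \<open>J\<close> vanishes on the range of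
  \<open>lam - T\<close>, by \<open>J T = N J\<close> and \<open>ell_N\<close>, and takes the value
  \<open>lam\<close> at \<open>V\<close>. This determines \<open>c\<close>; the remainder lies in
  the range by \<open>resolvent_on_kernel\<close> at \<open>lam\<close>.\<close>

lemma simple_eigenvalue: "Lp_simple_eigenvalue p M T K.lam"
  unfolding Lp_simple_eigenvalue_def
proof (intro bexI[OF _ V_Lp] conjI ballI impI V_eigen V_nonzero)
  fix \<phi> assume \<phi>: "\<phi> \<in> Lp p M" and eig: "AE x in M. T \<phi> x = K.lam * \<phi> x"
  \<comment> \<open>An eigenvector is recovered from its image under \<open>J\<close>, so it
    suffices to identify \<open>J \<phi>\<close>.\<close>
  have eq: "AE x in M. \<phi> x = (1 / K.lam) * (of_real (h x) * J \<phi> x)"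
    using eig T_eq_J[OF \<phi>] by eventually_elim (use K.lam_nonzero in \<open>simp add: field_simps\<close>)
  note hJ = hB[OF J_B[OF \<phi>]]
  have "K.N (J \<phi>) x = K.lam * J \<phi> x" for x
  proof -
    have "J \<phi> x = J (\<lambda>x. (1 / K.lam) * (of_real (h x) * J \<phi> x) + 0 * \<phi> x) x"
      using eq by (intro J_cong Lp_measurable[OF \<phi>] Lp_measurable[OF Lp_lin[OF p hJ \<phi>]]) simp
    also have "\<dots> = (1 / K.lam) * K.N (J \<phi>) x + 0 * J \<phi> x"
      by (simp only: J_lin[OF hJ \<phi>] J_h[OF J_B[OF \<phi>]])
    finally show ?thesis using K.lam_nonzero by (simp add: field_simps)
  qed
  then have J_eq: "J \<phi> x = K.ell (J \<phi>) * K.v x" for x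
    using K.eigenfunction_unique[OF J_B[OF \<phi>] K.rho(2), of x] by simp
  have "AE x in M. \<phi> x = (K.ell (J \<phi>) / K.lam) * V x"
    using eq
  proof eventually_elim
    case (elim x)
    then show ?case by (subst (asm) J_eq) (simp add: V_def)
  qed
  then show "\<exists>c. AE x in M. \<phi> x = c * V x" by blast
next
  fix f :: "'a \<Rightarrow> complex" assume f: "f \<in> Lp p M"
  let ?c = "K.ell (J f) / K.lam"
  show "\<exists>!c. \<exists>u\<in>Lp p M. AE x in M. f x = c * V x + (K.lam * u x - T u x)"
  proof (rule ex1I[of _ ?c])
    define g where "g x = (1 / K.lam) * J f x + (- ?c) * K.v x" for x
    have gB: "g \<in> K.B" unfolding g_def[abs_def] by (rule K.B_lin[OF J_B[OF f] K.v(1)])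
    have ell_g: "K.ell g = 0"
      unfolding g_def[abs_def] K.ell_lin[OF J_B[OF f] K.v(1)] K.v(2) by simp
    obtain r where r: "r > 0" "\<And>x. cmod (g x) \<le> r" using K.B_bound[OF gB] by blast
    obtain w where w: "w \<in> K.B" "\<And>x. K.lam * w x - K.N w x = g x"
      using K.resolvent_on_kernel[OF gB r ell_g K.rho(2)] by blast
    \<comment> \<open>From \<open>(lam - N) w = g\<close> follows
      \<open>(lam - T) u = f + h (lam w - N w - J f / lam) = f - ?c V\<close>.\<close>
    define u where "u x = (1 / K.lam) * f x + 1 * (of_real (h x) * w x)" for x
    have u: "u \<in> Lp p M" unfolding u_def[abs_def] by (rule Lp_lin[OF p f hB[OF w(1)]])
    have Ju: "J u x = (1 / K.lam) * J f x + K.N w x" for x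
      unfolding u_def[abs_def] J_lin[OF f hB[OF w(1)]] J_h[OF w(1)] by simp
    have "AE x in M. f x = ?c * V x + (K.lam * u x - T u x)"
      using T_eq_J[OF u]
    proof eventually_elim
      case (elim x)
      have Nw: "K.N w x = K.lam * w x - (1 / K.lam) * J f x + ?c * K.v x"
        using w(2)[of x, symmetric] by (simp add: g_def algebra_simps)
      show ?case unfolding elim Ju Nw V_def u_def
        using K.lam_nonzero by (simp add: algebra_simps)
    qed
    then show "\<exists>u\<in>Lp p M. AE x in M. f x = ?c * V x + (K.lam * u x - T u x)" using u by blast
  next
    fix c assume "\<exists>u\<in>Lp p M. AE x in M. f x = c * V x + (K.lam * u x - T u x)"
    then obtain u where u: "u \<in> Lp p M" and eq: "AE x in M. f x = c * V x + (K.lam * u x - T u x)" by blast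
    note ru = resolvent_arg_Lp[OF u, of K.lam]
    have 1: "J f x = J (\<lambda>x. c * V x + 1 * (K.lam * u x - T u x)) x" for x
      using eq by (intro J_cong Lp_measurable[OF f] Lp_measurable[OF Lp_lin[OF p V_Lp ru]]) simp
    have Jf: "J f = (\<lambda>x. (c * K.lam) * K.v x + 1 * (K.lam * J u x + (- 1) * K.N (J u) x))"
    proof
      show "J f x = (c * K.lam) * K.v x + 1 * (K.lam * J u x + (- 1) * K.N (J u) x)" for x
        unfolding 1 J_lin[OF V_Lp ru] J_V J_resolvent_arg[OF u] by simp
    qed
    have "(\<lambda>x. K.lam * J u x + (- 1) * K.N (J u) x) \<in> K.B"
      by (intro K.B_lin J_B u K.N_B)
    then have "K.ell (J f) = (c * K.lam) * K.ell K.v + 1 * K.ell (\<lambda>x. K.lam * J u x + (- 1) * K.N (J u) x)"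
      unfolding Jf by (rule K.ell_lin[OF K.v(1)])
    also have "K.ell (\<lambda>x. K.lam * J u x + (- 1) * K.N (J u) x) = K.lam * K.ell (J u) + (- 1) * K.ell (K.N (J u))"
      by (rule K.ell_lin[OF J_B[OF u] K.N_B[OF J_B[OF u]]])
    finally show "c = ?c" using K.lam_nonzero by (simp add: K.v(2) K.ell_N[OF J_B[OF u]])
  qed
qed

theorem spectral_gap: "Lp_spectral_gap p M T"
proof -
  have sub: "z = K.lam \<or> cmod z \<le> K.\<rho>" if "z \<in> Lp_spectrum p M T" for z
    using resolvent_set[of z] that by (auto simp: Lp_spectrum_def not_less[symmetric])
  have rad: "Lp_spectral_radius p M T = cmod K.lam"
    unfolding Lp_spectral_radius_def
  proof (rule cSup_eq_maximum)
    show "cmod K.lam \<in> cmod ` Lp_spectrum p M T" using lam_in_spectrum by blast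
    show "y \<le> cmod K.lam" if "y \<in> cmod ` Lp_spectrum p M T" for y
      using that sub K.rho by force
  qed
  have "K.lam isolated_in Lp_spectrum p M T"
    unfolding isolated_in_def
  proof (intro conjI lam_in_spectrum exI[of _ "- cball 0 K.\<rho>"])
    show "- cball 0 K.\<rho> \<inter> Lp_spectrum p M T = {K.lam}"
      using lam_in_spectrum K.rho by (auto dest: sub)
  qed auto
  then show ?thesis
    unfolding Lp_spectral_gap_def rad using T_bounded_op simple_eigenvalue K.rho
    by (intro conjI exI[of _ K.lam] exI[of _ K.\<rho>]) (auto dest: sub)
qed

end

section \<open>The spectral gap\<close>

text \<open>Boundedness on a space that is not null makes both essential suprema finite. Thus
  \<open>real_of_ereal\<close> applied to \<open>osc\<close> returns the true oscillation.\<close>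

lemma essential_range:
  fixes u :: "'a \<Rightarrow> real"
  assumes [measurable]: "u \<in> borel_measurable P" and bd: "AE z in P. \<bar>u z\<bar> \<le> c"
    and ne: "ae_filter P \<noteq> bot"
  obtains l r where "l \<le> r" "AE z in P. l \<le> u z \<and> u z \<le> r" "osc P u = ereal (r - l)"
proof -
  have fin: "\<exists>s. esssup P (\<lambda>z. ereal (w z)) = ereal s"
    if [measurable]: "w \<in> borel_measurable P" and w: "AE z in P. \<bar>w z\<bar> \<le> c" for w
  proof -
    have up: "esssup P (\<lambda>z. ereal (w z)) \<le> ereal c"
      using w by (intro esssup_I) (measurable, auto)
    have "esssup P (\<lambda>z. ereal (w z)) \<noteq> - \<infinity>"
    proof
      assume "esssup P (\<lambda>z. ereal (w z)) = - \<infinity>"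
      then have "AE z in P. ereal (w z) \<le> - \<infinity>" using esssup_AE[of "\<lambda>z. ereal (w z)" P] by simp
      then have "AE z in P. False" by eventually_elim simp
      then show False using ne by (simp add: trivial_limit_def)
    qed
    then show ?thesis using up by (cases "esssup P (\<lambda>z. ereal (w z))") auto
  qed
  obtain r where r: "esssup P (\<lambda>z. ereal (u z)) = ereal r" using fin[of u] bd by auto
  obtain s where s: "esssup P (\<lambda>z. ereal (- u z)) = ereal s" using fin[of "\<lambda>z. - u z"] bd by auto
  have "AE z in P. ereal (u z) \<le> ereal r" using esssup_AE[of "\<lambda>z. ereal (u z)" P] by (simp only: r)
  moreover have "AE z in P. ereal (- u z) \<le> ereal s" using esssup_AE[of "\<lambda>z. ereal (- u z)" P] by (simp only: s)
  ultimately have box: "AE z in P. - s \<le> u z \<and> u z \<le> r" by eventually_elim auto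
  then have "AE z in P. - s \<le> r" by eventually_elim simp
  then have "- s \<le> r" using ne by (simp add: eventually_const)
  then show thesis using box by (intro that[of "- s" r]) (simp_all add: osc_def r s)
qed

text \<open>The product is \<open>exp (z + cnj w)\<close>: real parts add, which doubles the
  exponents, and imaginary parts subtract, which leaves an angle of at most
  \<open>iu - il\<close>.\<close>

lemma sector_bounds:
  fixes z w :: complex
  assumes z: "rl \<le> Re z" "Re z \<le> ru" "il \<le> Im z" "Im z \<le> iu"
    and w: "rl \<le> Re w" "Re w \<le> ru" "il \<le> Im w" "Im w \<le> iu"
    and angle: "iu - il < pi / 2"
  shows "exp (2 * rl) * cos (iu - il) \<le> Re (exp z * cnj (exp w))"
    and "\<bar>Im (exp z * cnj (exp w))\<bar> \<le> exp (2 * ru) * sin (iu - il)"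
proof -
  define d where "d = \<bar>Im z - Im w\<bar>"
  have d: "0 \<le> d" "d \<le> iu - il" using z w by (auto simp: d_def)
  have prod: "exp z * cnj (exp w) = exp (z + cnj w)" by (simp add: exp_add exp_cnj)
  have Re: "Re (exp z * cnj (exp w)) = exp (Re z + Re w) * cos d"
    unfolding prod by (simp add: Re_exp d_def cos_abs_real del: exp_add)
  have Im: "\<bar>Im (exp z * cnj (exp w))\<bar> = exp (Re z + Re w) * \<bar>sin (Im z - Im w)\<bar>"
    unfolding prod by (simp add: Im_exp abs_mult)
  have "\<bar>sin (Im z - Im w)\<bar> = \<bar>sin d\<bar>"
  proof (cases "0 \<le> Im z - Im w")
    case False
    then have "d = - (Im z - Im w)" by (simp add: d_def)
    then have "sin d = - sin (Im z - Im w)" by (simp only: sin_minus)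
    then show ?thesis by simp
  qed (simp add: d_def)
  also have "\<dots> = sin d" using d angle by (intro abs_of_nonneg sin_ge_zero) auto
  finally have sin: "\<bar>sin (Im z - Im w)\<bar> = sin d" .
  have cos_le: "cos (iu - il) \<le> cos d" using d angle by (intro cos_monotone_0_pi_le) auto
  have cos_pos: "0 \<le> cos (iu - il)" using d angle by (intro cos_ge_zero) auto
  have sin_le: "sin d \<le> sin (iu - il)" using d angle by (intro sin_monotone_2pi_le) auto
  have sin_pos: "0 \<le> sin d" using d angle by (intro sin_ge_zero) auto
  show "exp (2 * rl) * cos (iu - il) \<le> Re (exp z * cnj (exp w))"
    unfolding Re using z w cos_le cos_pos by (intro mult_mono) auto
  show "\<bar>Im (exp z * cnj (exp w))\<bar> \<le> exp (2 * ru) * sin (iu - il)"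
    unfolding Im sin using z w sin_le sin_pos by (intro mult_mono) auto
qed

theorem theorem7p2:
  fixes M :: "'a measure" and p q :: ennreal
    and h m :: "'a \<Rightarrow> real" and g :: "'a \<times> 'a \<Rightarrow> complex"
    and \<theta> \<Lambda> :: real
  assumes "1 \<le> p" and "1 / p + 1 / q = 1"
    and "h \<in> Lp p M" and "AE x in M. h x > 0"
    and "m \<in> Lp q M" and "AE x in M. m x > 0"
    and "0 < (\<integral>\<^sup>+ x. ennreal (h x * m x) \<partial>M)"
    and "(\<integral>\<^sup>+ x. ennreal (h x * m x) \<partial>M) < \<infinity>"
    and "g \<in> Lp \<infinity> (M \<Otimes>\<^sub>M M)"
    and "\<theta> = real_of_ereal (osc (M \<Otimes>\<^sub>M M) (\<lambda>z. Im (g z)))"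
    and "\<Lambda> = real_of_ereal (osc (M \<Otimes>\<^sub>M M) (\<lambda>z. Re (g z)))"
    and "\<theta> < pi / 4" and "tan \<theta> < exp (- 2 * \<Lambda>)"
  shows "Lp_spectral_gap p M (integral_op M h m g)"
proof -
  note h_pos = assms(4) and m_pos = assms(6)
  note [measurable] = Lp_measurable[OF assms(3)] Lp_measurable[OF assms(5)] Lp_measurable[OF assms(9)]
  have hm_pos: "AE x in M. 0 < h x * m x" using h_pos m_pos by eventually_elim simp
  interpret sigma_finite_measure M
    using hm_pos assms(8) by (intro sigma_finite_measure_if_pos_integrable[of "\<lambda>x. h x * m x"]) measurable
  interpret P: pair_sigma_finite M M ..
  let ?P = "M \<Otimes>\<^sub>M M"
  have M_ne: "ae_filter M \<noteq> bot"
  proof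
    assume "ae_filter M = bot"
    then have "AE x in M. False" by (simp add: trivial_limit_def)
    then have "AE x in M. ennreal (h x * m x) = 0" by eventually_elim simp
    then have "(\<integral>\<^sup>+ x. ennreal (h x * m x) \<partial>M) = 0" by (subst nn_integral_0_iff_AE) auto
    then show False using assms(7) by simp
  qed
  have P_ne: "ae_filter ?P \<noteq> bot"
  proof
    assume "ae_filter ?P = bot"
    then have "AE z in ?P. False" by (simp add: trivial_limit_def)
    then have "AE x in M. AE y in M. False" by (rule P.AE_pair)
    then show False using M_ne by (simp add: eventually_const)
  qed
  have g_bd: "AE z in ?P. cmod (g z) \<le> Lp_norm \<infinity> ?P g" by (rule Linf_AE_le_norm[OF assms(9)])
  have "AE z in ?P. \<bar>Re (g z)\<bar> \<le> Lp_norm \<infinity> ?P g"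
    using g_bd by eventually_elim (rule order_trans[OF abs_Re_le_cmod])
  then obtain rl ru where R: "rl \<le> ru" "AE z in ?P. rl \<le> Re (g z) \<and> Re (g z) \<le> ru"
    "osc ?P (\<lambda>z. Re (g z)) = ereal (ru - rl)"
    using essential_range[of "\<lambda>z. Re (g z)" ?P] P_ne by auto
  have "AE z in ?P. \<bar>Im (g z)\<bar> \<le> Lp_norm \<infinity> ?P g"
    using g_bd by eventually_elim (rule order_trans[OF abs_Im_le_cmod])
  then obtain il iu where I: "il \<le> iu" "AE z in ?P. il \<le> Im (g z) \<and> Im (g z) \<le> iu"
    "osc ?P (\<lambda>z. Im (g z)) = ereal (iu - il)"
    using essential_range[of "\<lambda>z. Im (g z)" ?P] P_ne by auto
  have \<theta>: "\<theta> = iu - il" and \<Lambda>: "\<Lambda> = ru - rl" using assms(10,11) R(3) I(3) by simp_all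
  \<comment> \<open>The bounds on \<open>g\<close> hold only almost everywhere; \<open>f\<close> satisfies them at every point.\<close>
  define G where "G = {z \<in> space ?P. (rl \<le> Re (g z) \<and> Re (g z) \<le> ru) \<and> (il \<le> Im (g z) \<and> Im (g z) \<le> iu)}"
  have G: "G \<in> sets ?P" unfolding G_def by measurable
  \<comment> \<open>The default is a corner of the box, so the bounds persist. As \<open>G\<close>
    lies in the product space, sections over \<open>x\<close> outside \<open>space M\<close> are
    constant and so measurable.\<close>
  define f where "f z = (if z \<in> G then g z else Complex rl il)" for z
  define k where "k x y = exp (f (x, y))" for x y
  have f_box: "rl \<le> Re (f z)" "Re (f z) \<le> ru" "il \<le> Im (f z)" "Im (f z) \<le> iu" for z
    using R(1) I(1) by (auto simp: f_def G_def)
  have [measurable]: "f \<in> borel_measurable ?P"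
    unfolding f_def[abs_def] using G by measurable
  have k_joint: "case_prod k \<in> borel_measurable ?P"
  proof -
    have "case_prod k = (\<lambda>z. exp (f z))" by (auto simp: k_def)
    then show ?thesis by simp
  qed
  have k_section: "k x \<in> borel_measurable M" for x
  proof (cases "x \<in> space M")
    case True
    then have "(\<lambda>y. f (x, y)) \<in> borel_measurable M" by measurable
    then show ?thesis unfolding k_def[abs_def] by measurable
  next
    case False
    then have "k x = (\<lambda>y. exp (Complex rl il))" by (auto simp: k_def f_def G_def space_pair_measure)
    then show ?thesis by simp
  qed
  \<comment> \<open>Since \<open>ru - \<Lambda> = rl\<close>, multiplying the hypothesis by
    \<open>exp (2 * ru) * cos \<theta>\<close> gives \<open>D < A\<close> for the sector
    kernel.\<close>
  have gap: "exp (2 * ru) * sin \<theta> < exp (2 * rl) * cos \<theta>"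
  proof -
    have "cos \<theta> > 0" using assms(12) I(1) by (intro cos_gt_zero_pi) (auto simp: \<theta>)
    then have "sin \<theta> < exp (- 2 * \<Lambda>) * cos \<theta>"
      using assms(13) by (simp add: tan_def divide_less_eq)
    then have "exp (2 * ru) * sin \<theta> < exp (2 * ru) * (exp (- 2 * \<Lambda>) * cos \<theta>)" by simp
    also have "\<dots> = exp (2 * rl) * cos \<theta>"
      by (simp add: \<Lambda> mult.assoc[symmetric] exp_add[symmetric])
    finally show ?thesis .
  qed
  let ?D = "density M (\<lambda>x. ennreal (h x * m x))"
  have D_space: "emeasure ?D (space ?D) = (\<integral>\<^sup>+ x. ennreal (h x * m x) \<partial>M)"
    by (simp add: emeasure_density cong: nn_integral_cong)
  have sets_D: "sets (?D \<Otimes>\<^sub>M ?D) = sets ?P" by (intro sets_pair_measure_cong) auto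
  interpret K: sector_kernel ?D k "exp ru" "exp (2 * rl) * cos \<theta>" "exp (2 * ru) * sin \<theta>"
  proof (intro sector_kernel.intro sector_kernel_axioms.intro finite_measureI)
    show "emeasure ?D (space ?D) \<noteq> \<infinity>" using assms(8) unfolding D_space by simp
    show "emeasure ?D (space ?D) \<noteq> 0" using assms(7) unfolding D_space by simp
    show "case_prod k \<in> borel_measurable (?D \<Otimes>\<^sub>M ?D)" using k_joint sets_D by (simp cong: measurable_cong_sets)
    show "k x \<in> borel_measurable ?D" for x using k_section by simp
    show "cmod (k x y) \<le> exp ru" for x y using f_box by (simp add: k_def)
    have "iu - il < pi / 2" using assms(12) I(1) unfolding \<theta> by linarith
    note sb = sector_bounds[OF f_box f_box this]
    show "exp (2 * rl) * cos \<theta> \<le> Re (k x y * cnj (k x' y'))" for x y x' y'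
      unfolding k_def \<theta> by (rule sb(1))
    show "\<bar>Im (k x y * cnj (k x' y'))\<bar> \<le> exp (2 * ru) * sin \<theta>" for x y x' y'
      unfolding k_def \<theta> by (rule sb(2))
    show "exp (2 * ru) * sin \<theta> < exp (2 * rl) * cos \<theta>" by (rule gap)
  qed
  obtain C where C: "0 \<le> C"
    "\<And>\<phi> :: 'a \<Rightarrow> complex. \<phi> \<in> Lp p M \<Longrightarrow> integrable M (\<lambda>x. \<phi> x * of_real (m x))"
    "\<And>\<phi> :: 'a \<Rightarrow> complex. \<phi> \<in> Lp p M \<Longrightarrow> (LINT x|M. cmod (\<phi> x * of_real (m x))) \<le> C * Lp_norm p M \<phi>"
    using Lp_pairing[OF assms(1,2,5)] by blast
  have "AE z in ?P. f z = g z"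
    using R(2) I(2) AE_space[of ?P] by eventually_elim (simp add: f_def G_def)
  \<comment> \<open>A null set of the product has null sections over almost every \<open>x\<close>,
    where the integral defining the operator is therefore unchanged.\<close>
  then have fg: "AE x in M. AE y in M. f (x, y) = g (x, y)" by (rule P.AE_pair)
  interpret factored_operator M h m k "exp ru" "exp (2 * rl) * cos \<theta>" "exp (2 * ru) * sin \<theta>" p C
    "integral_op M h m g"
  proof unfold_locales
    fix \<phi> :: "'a \<Rightarrow> complex" assume \<phi>: "\<phi> \<in> Lp p M"
    note [measurable] = Lp_measurable[OF \<phi>]
    show "integral_op M h m g \<phi> \<in> borel_measurable M" unfolding integral_op_def by measurable
    show "AE x in M. integral_op M h m g \<phi> x = of_real (h x) * (LINT y|M. k x y * (\<phi> y * of_real (m y)))"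
      using fg AE_space
    proof eventually_elim
      case (elim x)
      note x = elim(2)
      have "(LINT y|M. exp (g (x, y)) * \<phi> y * of_real (m y)) = (LINT y|M. k x y * (\<phi> y * of_real (m y)))"
      proof (rule integral_cong_AE)
        show "(\<lambda>y. exp (g (x, y)) * \<phi> y * of_real (m y)) \<in> borel_measurable M" using x by measurable
        show "(\<lambda>y. k x y * (\<phi> y * of_real (m y))) \<in> borel_measurable M" using k_section by measurable
        show "AE y in M. exp (g (x, y)) * \<phi> y * of_real (m y) = k x y * (\<phi> y * of_real (m y))"
          using elim(1) by eventually_elim (simp add: k_def mult.assoc)
      qed
      then show ?case by (simp add: integral_op_def)
    qed
  qed (use assms C in \<open>auto dest: Lp_measurable\<close>)
  show ?thesis by (rule spectral_gap)
qed

end
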